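(* Let $M$ be a real smooth $n$-dimensional manifold, $S$ a spray on $M$, and let $P_1=(\mathcal{L}_{\mathbb{C}},d_J,d_h)$ be the projective metrizability operator of $S$, a first-order linear partial differential operator from semi-basic $1$-forms on $TM\setminus\{0\}$ to sections of $T^*_v\oplus\Lambda^2T^*_v\oplus\Lambda^2T^*_v$. Then the symbol $\sigma^1(P_1)$ is involutive (at every point $u\in TM\setminus\{0\}$).
   Context: $TM\setminus\{0\}$ is the tangent bundle $\pi:TM\to M$ with the zero section removed, with induced coordinates $(x^i,y^i)$. The Liouville vector field is $\mathbb{C}=y^i\frac{\partial}{\partial y^i}$ and the tangent structure is $J=\frac{\partial}{\partial y^i}\otimes dx^i$. A spray is a smooth vector field $S$ on $TM\setminus\{0\}$ with $JS=\mathbb{C}$ and $[\mathbb{C},S]=S$. It induces the horizontal projector $h=\frac12(\mathrm{Id}-\mathcal{L}_SJ)$, where $(\mathcal{L}_SJ)(X)=[S,JX]-J[S,X]$. All bundles are over $TM\setminus\{0\}$: $T^*$ is the cotangent bundle of $TM\setminus\{0\}$, $S^kT^*$ the bundle of symmetric $(0,k)$-tensors, and $T^*_v$, $\Lambda^kT^*_v$ the bundles of semi-basic $1$-forms, $k$-forms (forms vanishing whenever one argument is vertical, i.e. in $\ker D\pi$). For a vector valued $1$-form $L$, $i_L\omega(X_1,\dots,X_k)=\sum_i\omega(X_1,\dots,LX_i,\dots,X_k)$ and $d_L=i_L\circ d-d\circ i_L$. The operators $\mathcal{L}_{\mathbb{C}}$, $d_J$, $d_h$ preserve semi-basic forms,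 so $P_1\theta=(\mathcal{L}_{\mathbb{C}}\theta,d_J\theta,d_h\theta)$ is well defined for semi-basic $1$-forms $\theta$. Put $F_1=T^*_v\oplus\Lambda^2T^*_v\oplus\Lambda^2T^*_v$. The symbol $\sigma^1(P_1):T^*\otimes T^*_v\to F_1$ is $\sigma^1(P_1)A=(i_{\mathbb{C}}A,\tau_JA,\tau_hA)$, with $(i_{\mathbb{C}}A)(X)=A(\mathbb{C},X)$, $(\tau_JA)(X,Y)=A(JX,Y)-A(JY,X)$, $(\tau_hA)(X,Y)=A(hX,Y)-A(hY,X)$. Its first prolongation $\sigma^2(P_1):S^2T^*\otimes T^*_v\to T^*\otimes F_1$ is determined by $i_X(\sigma^2(P_1)B)=\sigma^1(P_1)(i_XB)$ for all vectors $X$. For $u\in TM\setminus\{0\}$ put $g^k_u(P_1)=\ker\sigma^k_u(P_1)$, $k=1,2$, and for a basis $\{e_1,\dots,e_{2n}\}$ of $T_u(TM\setminus\{0\})$ put $g^1_u(P_1)_{e_1\dots e_j}=\{A\in g^1_u(P_1): i_{e_1}A=\dots=i_{e_j}A=0\}$. The basis is quasi-regular if $$\dim g^2_u(P_1)=\dim g^1_u(P_1)+\sum_{j=1}^{2n}\dim g^1_u(P_1)_{e_1\dots e_j}.$$ The symbol $\sigma^1(P_1)$ is involutive at $u$ if there exists a quasi-regular basis of $T_u(TM\setminus\{0\})$. *)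

theory Defs
  imports "HOL-Analysis.Analysis" "HOL-Library.Function_Algebras"
begin

section \<open>Functions into a real vector space\<close>

text \<open>
  Tangent vectors and tensors at a point are represented below by functions that vanish outside
  their natural domain.  With the pointwise operations these functions form a real vector space,
  so that \<^const>\<open>span\<close>, \<^const>\<open>independent\<close> and \<^const>\<open>dim\<close> of the library apply to them.
\<close>

instantiation "fun" :: (type, real_vector) real_vector
begin

definition scaleR_fun_def: "r *\<^sub>R f = (\<lambda>x. r *\<^sub>R f x)"

instance
  by standard (simp_all add: scaleR_fun_def fun_eq_iff scaleR_add_right scaleR_add_left)

end


section \<open>Smooth manifolds\<close>

primrec Ck_on :: "nat \<Rightarrow> 'a::real_normed_vector set \<Rightarrow> ('a \<Rightarrow> 'b::real_normed_vector) \<Rightarrow> bool" where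
  "Ck_on 0 U f \<longleftrightarrow> continuous_on U f"
| "Ck_on (Suc k) U f \<longleftrightarrow> (\<forall>x\<in>U. f differentiable (at x)) \<and>
     (\<forall>v. Ck_on k U (\<lambda>x. frechet_derivative f (at x) v))"

text \<open>Only used for open \<open>U\<close>.\<close>
definition smooth_on :: "'a::real_normed_vector set \<Rightarrow> ('a \<Rightarrow> 'b::real_normed_vector) \<Rightarrow> bool" where
  "smooth_on U f \<longleftrightarrow> (\<forall>k. Ck_on k U f)"

text \<open>A chart is a pair of its domain and its coordinate map; the values of the coordinate map
  outside the domain play no role.\<close>

type_synonym ('p, 'e) chart = "'p set \<times> ('p \<Rightarrow> 'e)"

abbreviation cdom :: "('p, 'e) chart \<Rightarrow> 'p set" where "cdom c \<equiv> fst c"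
abbreviation cmap :: "('p, 'e) chart \<Rightarrow> 'p \<Rightarrow> 'e" where "cmap c \<equiv> snd c"
abbreviation cinv :: "('p, 'e) chart \<Rightarrow> 'e \<Rightarrow> 'p" where "cinv c \<equiv> inv_into (fst c) (snd c)"

definition local_rep :: "('p \<Rightarrow> 'q) \<Rightarrow> ('p, 'e) chart \<Rightarrow> ('q, 'f) chart \<Rightarrow> 'e \<Rightarrow> 'f" where
  "local_rep f c d = (\<lambda>x. cmap d (f (cinv c x)))"

definition carrier_of :: "('p, 'e) chart set \<Rightarrow> 'p set" where
  "carrier_of \<A> = (\<Union>c\<in>\<A>. cdom c)"

definition manifold_topology :: "('p, 'e::topological_space) chart set \<Rightarrow> 'p topology" where
  "manifold_topology \<A> = topology (\<lambda>W. W \<subseteq> carrier_of \<A> \<and> (\<forall>c\<in>\<A>. open (cmap c ` (W \<inter> cdom c))))"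

text \<open>A smooth manifold is given by a (not necessarily maximal) smooth atlas on the set
  \<^term>\<open>carrier_of \<A>\<close>.\<close>
definition smooth_manifold :: "('p, 'e::euclidean_space) chart set \<Rightarrow> bool" where
  "smooth_manifold \<A> \<longleftrightarrow>
     (\<forall>c\<in>\<A>. inj_on (cmap c) (cdom c) \<and> open (cmap c ` cdom c)) \<and>
     (\<forall>c\<in>\<A>. \<forall>d\<in>\<A>. open (cmap c ` (cdom c \<inter> cdom d)) \<and>
        smooth_on (cmap c ` (cdom c \<inter> cdom d)) (local_rep id c d)) \<and>
     Hausdorff_space (manifold_topology \<A>) \<and> second_countable (manifold_topology \<A>)"


section \<open>Tangent vectors and vector fields\<close>

text \<open>A tangent vector at \<open>p\<close> assigns to every chart around \<open>p\<close> its components in that chart, and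
  these transform by the Jacobians of the coordinate changes.  It is \<open>0\<close> on all other charts, so
  that the vector is determined by its components.\<close>

type_synonym ('p, 'e) tvec = "('p, 'e) chart \<Rightarrow> 'e"

definition tangent_space :: "('p, 'e::real_normed_vector) chart set \<Rightarrow> 'p \<Rightarrow> ('p, 'e) tvec set" where
  "tangent_space \<A> p = {v.
     (\<forall>c. \<not> (c \<in> \<A> \<and> p \<in> cdom c) \<longrightarrow> v c = 0) \<and>
     (\<forall>c\<in>\<A>. \<forall>d\<in>\<A>. p \<in> cdom c \<inter> cdom d \<longrightarrow>
        v d = frechet_derivative (local_rep id c d) (at (cmap c p)) (v c))}"

definition field_rep :: "('p \<Rightarrow> ('p, 'e) tvec) \<Rightarrow> ('p, 'e) chart \<Rightarrow> 'e \<Rightarrow> 'e" where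
  "field_rep X c = (\<lambda>x. X (cinv c x) c)"

definition smooth_vector_field_on ::
  "('p, 'e::real_normed_vector) chart set \<Rightarrow> 'p set \<Rightarrow> ('p \<Rightarrow> ('p, 'e) tvec) \<Rightarrow> bool" where
  "smooth_vector_field_on \<A> W X \<longleftrightarrow>
     openin (manifold_topology \<A>) W \<and>
     (\<forall>p\<in>W. X p \<in> tangent_space \<A> p) \<and>
     (\<forall>c\<in>\<A>. smooth_on (cmap c ` (W \<inter> cdom c)) (field_rep X c))"

text \<open>In coordinates, \<open>[X,Y]\<^sup>i = X\<^sup>k \<partial>Y\<^sup>i/\<partial>x\<^sup>k - Y\<^sup>k \<partial>X\<^sup>i/\<partial>x\<^sup>k\<close>.\<close>
definition lie_bracket :: "('p, 'e::real_normed_vector) chart set \<Rightarrow>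
    ('p \<Rightarrow> ('p, 'e) tvec) \<Rightarrow> ('p \<Rightarrow> ('p, 'e) tvec) \<Rightarrow> 'p \<Rightarrow> ('p, 'e) tvec" where
  "lie_bracket \<A> X Y p = (\<lambda>c. if c \<in> \<A> \<and> p \<in> cdom c
     then frechet_derivative (field_rep Y c) (at (cmap c p)) (X p c)
        - frechet_derivative (field_rep X c) (at (cmap c p)) (Y p c)
     else 0)"


section \<open>The slit tangent bundle\<close>

type_synonym ('p, 'e) tpoint = "'p \<times> ('p, 'e) tvec"

definition slit_tangent_bundle :: "('p, 'e::real_normed_vector) chart set \<Rightarrow> ('p, 'e) tpoint set" where
  "slit_tangent_bundle \<A> = {(p, y). p \<in> carrier_of \<A> \<and> y \<in> tangent_space \<A> p \<and> y \<noteq> 0}"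

text \<open>The induced coordinates \<open>(x\<^sup>i, y\<^sup>i)\<close>.\<close>
definition induced_chart :: "('p, 'e::real_normed_vector) chart set \<Rightarrow> ('p, 'e) chart \<Rightarrow>
    (('p, 'e) tpoint, 'e \<times> 'e) chart" where
  "induced_chart \<A> c =
     ({(p, y) \<in> slit_tangent_bundle \<A>. p \<in> cdom c}, \<lambda>(p, y). (cmap c p, y c))"

definition slit_atlas :: "('p, 'e::real_normed_vector) chart set \<Rightarrow>
    (('p, 'e) tpoint, 'e \<times> 'e) chart set" where
  "slit_atlas \<A> = induced_chart \<A> ` \<A>"

type_synonym ('p, 'e) ttvec = "(('p, 'e) tpoint, 'e \<times> 'e) tvec"

abbreviation slit_tangent_space :: "('p, 'e::real_normed_vector) chart set \<Rightarrow> ('p, 'e) tpoint \<Rightarrow>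
    ('p, 'e) ttvec set" where
  "slit_tangent_space \<A> u \<equiv> tangent_space (slit_atlas \<A>) u"

text \<open>The kernel of \<open>D\<pi>\<close> at \<open>u\<close>, where \<open>\<pi>\<close> is \<^const>\<open>fst\<close>.\<close>
definition vertical_space :: "('p, 'e::real_normed_vector) chart set \<Rightarrow> ('p, 'e) tpoint \<Rightarrow>
    ('p, 'e) ttvec set" where
  "vertical_space \<A> u = {\<xi> \<in> slit_tangent_space \<A> u.
     \<forall>K\<in>slit_atlas \<A>. \<forall>c\<in>\<A>. u \<in> cdom K \<and> fst u \<in> cdom c \<longrightarrow>
       frechet_derivative (local_rep fst K c) (at (cmap K u)) (\<xi> K) = 0}"

text \<open>The Liouville vector field \<open>y\<^sup>i \<partial>/\<partial>y\<^sup>i\<close>.\<close>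
definition liouville :: "('p, 'e::real_normed_vector) chart set \<Rightarrow> ('p, 'e) tpoint \<Rightarrow> ('p, 'e) ttvec" where
  "liouville \<A> u = (\<lambda>K. if K \<in> slit_atlas \<A> \<and> u \<in> cdom K then (0, snd (cmap K u)) else 0)"

text \<open>The tangent structure \<open>\<partial>/\<partial>y\<^sup>i \<otimes> dx\<^sup>i\<close>.\<close>
definition tangent_structure :: "('p, 'e::real_normed_vector) ttvec \<Rightarrow> ('p, 'e) ttvec" where
  "tangent_structure \<xi> = (\<lambda>K. (0, fst (\<xi> K)))"

definition spray :: "('p, 'e::real_normed_vector) chart set \<Rightarrow>
    (('p, 'e) tpoint \<Rightarrow> ('p, 'e) ttvec) \<Rightarrow> bool" where
  "spray \<A> S \<longleftrightarrow>
     smooth_vector_field_on (slit_atlas \<A>) (slit_tangent_bundle \<A>) S \<and>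
     (\<forall>u\<in>slit_tangent_bundle \<A>. tangent_structure (S u) = liouville \<A> u) \<and>
     (\<forall>u\<in>slit_tangent_bundle \<A>. lie_bracket (slit_atlas \<A>) (liouville \<A>) S u = S u)"

text \<open>\<open>(\<L>\<^sub>S J)(X) = [S, JX] - J[S, X]\<close>\<close>
definition lie_derivative_J :: "('p, 'e::real_normed_vector) chart set \<Rightarrow>
    (('p, 'e) tpoint \<Rightarrow> ('p, 'e) ttvec) \<Rightarrow> (('p, 'e) tpoint \<Rightarrow> ('p, 'e) ttvec) \<Rightarrow>
    ('p, 'e) tpoint \<Rightarrow> ('p, 'e) ttvec" where
  "lie_derivative_J \<A> S X u =
     lie_bracket (slit_atlas \<A>) S (\<lambda>w. tangent_structure (X w)) u
     - tangent_structure (lie_bracket (slit_atlas \<A>) S X u)"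

text \<open>\<open>h = (Id - \<L>\<^sub>S J)/2\<close> is a tensor field: its value on a vector \<open>\<xi>\<close> at \<open>u\<close> is computed with any
  vector field \<open>X\<close> defined near \<open>u\<close> that extends \<open>\<xi>\<close>.\<close>
definition horizontal_projector :: "('p, 'e::real_normed_vector) chart set \<Rightarrow>
    (('p, 'e) tpoint \<Rightarrow> ('p, 'e) ttvec) \<Rightarrow> ('p, 'e) tpoint \<Rightarrow> ('p, 'e) ttvec \<Rightarrow> ('p, 'e) ttvec" where
  "horizontal_projector \<A> S u \<xi> = (THE \<eta>. \<exists>W X. u \<in> W \<and>
     smooth_vector_field_on (slit_atlas \<A>) W X \<and> X u = \<xi> \<and>
     \<eta> = (1/2) *\<^sub>R (\<xi> - lie_derivative_J \<A> S X u))"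


section \<open>Tensors at a point\<close>

text \<open>Linear maps from a subspace \<open>T\<close> to a subspace \<open>E\<close>, extended by \<open>0\<close> outside \<open>T\<close>.  We identify
  \<open>T\<^sup>* \<otimes> E\<close> with \<open>hom_on T E\<close>, so that the interior product \<open>i\<^sub>X A\<close> is the application \<open>A X\<close>.\<close>
definition hom_on :: "'v::real_vector set \<Rightarrow> 'w::real_vector set \<Rightarrow> ('v \<Rightarrow> 'w) set" where
  "hom_on T E = {f. (\<forall>x\<in>T. f x \<in> E) \<and> (\<forall>x. x \<notin> T \<longrightarrow> f x = 0) \<and>
     (\<forall>x\<in>T. \<forall>y\<in>T. f (x + y) = f x + f y) \<and> (\<forall>r. \<forall>x\<in>T. f (r *\<^sub>R x) = r *\<^sub>R f x)}"

definition semibasic_forms :: "('p, 'e::real_normed_vector) chart set \<Rightarrow> ('p, 'e) tpoint \<Rightarrow>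
    (('p, 'e) ttvec \<Rightarrow> real) set" where
  "semibasic_forms \<A> u = {\<theta> \<in> hom_on (slit_tangent_space \<A> u) UNIV. \<forall>X\<in>vertical_space \<A> u. \<theta> X = 0}"

text \<open>\<open>T\<^sup>* \<otimes> T\<^sup>*\<^sub>v\<close>\<close>
definition tensors1 :: "('p, 'e::real_normed_vector) chart set \<Rightarrow> ('p, 'e) tpoint \<Rightarrow>
    (('p, 'e) ttvec \<Rightarrow> ('p, 'e) ttvec \<Rightarrow> real) set" where
  "tensors1 \<A> u = hom_on (slit_tangent_space \<A> u) (semibasic_forms \<A> u)"

text \<open>\<open>S\<^sup>2T\<^sup>* \<otimes> T\<^sup>*\<^sub>v\<close>\<close>
definition tensors2 :: "('p, 'e::real_normed_vector) chart set \<Rightarrow> ('p, 'e) tpoint \<Rightarrow>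
    (('p, 'e) ttvec \<Rightarrow> ('p, 'e) ttvec \<Rightarrow> ('p, 'e) ttvec \<Rightarrow> real) set" where
  "tensors2 \<A> u = {B \<in> hom_on (slit_tangent_space \<A> u) (tensors1 \<A> u).
     \<forall>X\<in>slit_tangent_space \<A> u. \<forall>Y\<in>slit_tangent_space \<A> u. B X Y = B Y X}"


section \<open>The symbol of the projective metrizability operator and its involutivity\<close>

text \<open>\<open>(\<tau>\<^sub>L A)(X, Y) = A(LX, Y) - A(LY, X)\<close> for an endomorphism \<open>L\<close> of the tangent space at \<open>u\<close>.\<close>
definition tau :: "('p, 'e::real_normed_vector) chart set \<Rightarrow> ('p, 'e) tpoint \<Rightarrow>
    (('p, 'e) ttvec \<Rightarrow> ('p, 'e) ttvec) \<Rightarrow> (('p, 'e) ttvec \<Rightarrow> ('p, 'e) ttvec \<Rightarrow> real) \<Rightarrow>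
    ('p, 'e) ttvec \<Rightarrow> ('p, 'e) ttvec \<Rightarrow> real" where
  "tau \<A> u L A = (\<lambda>X Y. if X \<in> slit_tangent_space \<A> u \<and> Y \<in> slit_tangent_space \<A> u
     then A (L X) Y - A (L Y) X else 0)"

definition symbol1 :: "('p, 'e::real_normed_vector) chart set \<Rightarrow>
    (('p, 'e) tpoint \<Rightarrow> ('p, 'e) ttvec) \<Rightarrow> ('p, 'e) tpoint \<Rightarrow>
    (('p, 'e) ttvec \<Rightarrow> ('p, 'e) ttvec \<Rightarrow> real) \<Rightarrow>
    (('p, 'e) ttvec \<Rightarrow> real) \<times> (('p, 'e) ttvec \<Rightarrow> ('p, 'e) ttvec \<Rightarrow> real) \<times>
    (('p, 'e) ttvec \<Rightarrow> ('p, 'e) ttvec \<Rightarrow> real)" where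
  "symbol1 \<A> S u A =
     (A (liouville \<A> u), tau \<A> u tangent_structure A, tau \<A> u (horizontal_projector \<A> S u) A)"

definition symbol2 :: "('p, 'e::real_normed_vector) chart set \<Rightarrow>
    (('p, 'e) tpoint \<Rightarrow> ('p, 'e) ttvec) \<Rightarrow> ('p, 'e) tpoint \<Rightarrow>
    (('p, 'e) ttvec \<Rightarrow> ('p, 'e) ttvec \<Rightarrow> ('p, 'e) ttvec \<Rightarrow> real) \<Rightarrow> ('p, 'e) ttvec \<Rightarrow>
    (('p, 'e) ttvec \<Rightarrow> real) \<times> (('p, 'e) ttvec \<Rightarrow> ('p, 'e) ttvec \<Rightarrow> real) \<times>
    (('p, 'e) ttvec \<Rightarrow> ('p, 'e) ttvec \<Rightarrow> real)" where
  "symbol2 \<A> S u B = (\<lambda>X. symbol1 \<A> S u (B X))"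

definition g1 :: "('p, 'e::real_normed_vector) chart set \<Rightarrow>
    (('p, 'e) tpoint \<Rightarrow> ('p, 'e) ttvec) \<Rightarrow> ('p, 'e) tpoint \<Rightarrow>
    (('p, 'e) ttvec \<Rightarrow> ('p, 'e) ttvec \<Rightarrow> real) set" where
  "g1 \<A> S u = {A \<in> tensors1 \<A> u. symbol1 \<A> S u A = 0}"

definition g2 :: "('p, 'e::real_normed_vector) chart set \<Rightarrow>
    (('p, 'e) tpoint \<Rightarrow> ('p, 'e) ttvec) \<Rightarrow> ('p, 'e) tpoint \<Rightarrow>
    (('p, 'e) ttvec \<Rightarrow> ('p, 'e) ttvec \<Rightarrow> ('p, 'e) ttvec \<Rightarrow> real) set" where
  "g2 \<A> S u = {B \<in> tensors2 \<A> u. symbol2 \<A> S u B = 0}"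

definition g1_sub :: "('p, 'e::real_normed_vector) chart set \<Rightarrow>
    (('p, 'e) tpoint \<Rightarrow> ('p, 'e) ttvec) \<Rightarrow> ('p, 'e) tpoint \<Rightarrow> ('p, 'e) ttvec list \<Rightarrow>
    (('p, 'e) ttvec \<Rightarrow> ('p, 'e) ttvec \<Rightarrow> real) set" where
  "g1_sub \<A> S u es = {A \<in> g1 \<A> S u. \<forall>e\<in>set es. A e = 0}"

definition is_basis :: "'v::real_vector set \<Rightarrow> 'v list \<Rightarrow> bool" where
  "is_basis T es \<longleftrightarrow> distinct es \<and> independent (set es) \<and> span (set es) = T"

definition quasi_regular :: "('p, 'e::euclidean_space) chart set \<Rightarrow>
    (('p, 'e) tpoint \<Rightarrow> ('p, 'e) ttvec) \<Rightarrow> ('p, 'e) tpoint \<Rightarrow> ('p, 'e) ttvec list \<Rightarrow> bool" where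
  "quasi_regular \<A> S u es \<longleftrightarrow>
     dim (g2 \<A> S u) = dim (g1 \<A> S u) + (\<Sum>j = 1..2 * DIM('e). dim (g1_sub \<A> S u (take j es)))"

definition symbol_involutive :: "('p, 'e::euclidean_space) chart set \<Rightarrow>
    (('p, 'e) tpoint \<Rightarrow> ('p, 'e) ttvec) \<Rightarrow> ('p, 'e) tpoint \<Rightarrow> bool" where
  "symbol_involutive \<A> S u \<longleftrightarrow>
     (\<exists>es. length es = 2 * DIM('e) \<and> is_basis (slit_tangent_space \<A> u) es \<and> quasi_regular \<A> S u es)"

end

theory Submission
  imports Defs
begin

text \<open>
  The involutivity of the symbol is a statement of linear algebra in an adapted frame.  At a point \<open>u\<close>
  take horizontal vectors \<open>H\<^sub>0, \<dots>, H\<^sub>m\<close> (\<open>h H\<^sub>i = H\<^sub>i\<close>) and \<open>v\<^sub>i = J H\<^sub>i\<close>, chosen so that \<open>v\<^sub>m\<close> is the Liouville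
  vector; let \<open>n = m + 1\<close>.  A tensor \<open>A\<close> in the kernel of the symbol is given by the matrices
  \<open>a i j = A (H i) (H j)\<close> and \<open>w i j = A (v i) (H j)\<close>, and the equations say that both are symmetric and
  that row \<open>m\<close> of \<open>w\<close> vanishes (\<open>G1_iff\<close>).  So the kernel has dimension
  \<open>n (n + 1) / 2 + n (n - 1) / 2 = n\<^sup>2\<close>.  An element of the kernel of the prolongation is likewise given
  by three totally symmetric arrays in three indices, according to the number of vertical arguments,
  and the two with vertical arguments live on the indices below \<open>m\<close>.  Hence its dimension is
  \<open>n (n + 1) (n + 2) / 6 + 2 (n - 1) n (n + 1) / 6 = n\<^sup>2 (n + 1) / 2\<close> (\<open>dim_G2\<close>).

  A quasi-regular basis has to be generic with respect to the splitting.  Here it consists of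
  \<open>e\<^sub>i = H\<^sub>i + i v\<^sub>i\<close> for \<open>i < m\<close>, of \<open>e\<^sub>m = H\<^sub>m + (\<Sum>k<m. v\<^sub>k)\<close>, and of all \<open>v\<^sub>i\<close> (\<open>regular_vec\<close>).  The \<open>n\<^sup>2\<close> numbers \<open>A (e i) (H j)\<close>
  determine \<open>A\<close> and can be prescribed (\<open>regular_components_inj\<close>, \<open>regular_components_surj\<close>).  So each of
  the first \<open>n\<close> basis vectors lowers the dimension by exactly \<open>n\<close>, and the required sum is
  \<open>n\<^sup>2 + (\<Sum>j=1..n. n (n - j)) = n\<^sup>2 (n + 1) / 2\<close> (\<open>cartan_equality\<close>).

  It remains to produce the frame on the slit tangent bundle.  A chart identifies the tangent space
  at \<open>u\<close> with pairs of coordinate vectors, since the induced charts form a smooth atlas.  The essential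
  point is that \<open>h\<close> is a well-defined endomorphism of the tangent space.  Any vector extends
  smoothly (\<open>smooth_extension\<close>), the Lie bracket of vector fields is tangent because second derivatives
  are symmetric (\<open>second_derivative_symmetric\<close>, \<open>lie_bracket_tangent\<close>), and in coordinates
  \<open>h (a, b) = (a, N a)\<close> for a linear map \<open>N\<close> that depends on the spray only (\<open>horizontal_projector\<close>).
\<close>

section \<open>Smooth functions and symmetry of second derivatives\<close>

lemma frechet_derivative_cong:
  assumes "open U" "x \<in> U" "\<And>y. y \<in> U \<Longrightarrow> f y = g y" "f differentiable (at x)"
  shows "g differentiable (at x)" "frechet_derivative g (at x) = frechet_derivative f (at x)"
proof -
  have "(f has_derivative frechet_derivative f (at x)) (at x)"
    using assms(4) by (simp add: frechet_derivative_works)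
  then have g: "(g has_derivative frechet_derivative f (at x)) (at x)"
    by (rule has_derivative_transform_within_open[OF _ assms(1,2)]) (rule assms(3))
  then show "g differentiable (at x)" by (rule differentiableI)
  show "frechet_derivative g (at x) = frechet_derivative f (at x)"
    by (rule frechet_derivative_at[OF g, symmetric])
qed

lemma frechet_derivative_eqI: "(f has_derivative f') (at x) \<Longrightarrow> frechet_derivative f (at x) = f'"
  by (rule frechet_derivative_at[symmetric])

lemma Ck_on_cong:
  assumes "open U" "Ck_on k U f" "\<And>x. x \<in> U \<Longrightarrow> f x = g x"
  shows "Ck_on k U g"
  using assms(2,3)
proof (induction k arbitrary: f g)
  case 0 then show ?case using continuous_on_cong[of U U f g] by simp
next
  case (Suc k)
  have D: "g differentiable (at x)" "frechet_derivative f (at x) = frechet_derivative g (at x)" if "x \<in> U" for x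
    using frechet_derivative_cong[OF assms(1) that, of f g] Suc.prems that by simp_all
  have "Ck_on k U (\<lambda>x. frechet_derivative g (at x) v)" for v
    by (rule Suc.IH[of "\<lambda>x. frechet_derivative f (at x) v"]) (use Suc.prems D in auto)
  then show ?case using D by simp
qed

lemma Ck_on_subset: "Ck_on k U f \<Longrightarrow> V \<subseteq> U \<Longrightarrow> Ck_on k V f"
  by (induction k arbitrary: f) (auto intro: continuous_on_subset)

text \<open>
  The recursive clause of \<open>Ck_on\<close> speaks of \<open>frechet_derivative\<close>; this form accepts any
  explicit derivative, which is what the closure properties below produce.
\<close>
lemma Ck_on_SucI:
  assumes "open U" "\<And>x. x \<in> U \<Longrightarrow> (f has_derivative f' x) (at x)" "\<And>v. Ck_on k U (\<lambda>x. f' x v)"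
  shows "Ck_on (Suc k) U f"
proof -
  have "Ck_on k U (\<lambda>x. frechet_derivative f (at x) v)" for v
    by (rule Ck_on_cong[OF assms(1) assms(3)[of v]]) (rule fun_cong[OF frechet_derivative_eqI[OF assms(2), symmetric]])
  then show ?thesis using assms(2) by (auto simp: differentiable_def)
qed

lemma Ck_on_Suc_has_derivative:
  "Ck_on (Suc k) U f \<Longrightarrow> x \<in> U \<Longrightarrow> (f has_derivative frechet_derivative f (at x)) (at x)"
  by (simp add: frechet_derivative_works)

lemma Ck_on_Suc_imp: "Ck_on (Suc k) U f \<Longrightarrow> Ck_on k U f"
proof (induction k arbitrary: f)
  case 0
  then show ?case
    by (auto intro!: continuous_at_imp_continuous_on differentiable_imp_continuous_within)
next
  case (Suc k)
  have "Ck_on k U (\<lambda>x. frechet_derivative f (at x) v)" for v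
    by (rule Suc.IH) (use Suc.prems in simp)
  then show ?case using Suc.prems by simp
qed

lemma Ck_on_const: "Ck_on k U (\<lambda>x. c)"
  by (induction k arbitrary: c) (auto simp: frechet_derivative_const)

lemma Ck_on_ident: "Ck_on k U (\<lambda>x. x)"
  by (cases k) (auto simp: Ck_on_const frechet_derivative_ident)

lemma Ck_on_bounded_linear:
  assumes "open U" "bounded_linear L" shows "Ck_on k U f \<Longrightarrow> Ck_on k U (\<lambda>x. L (f x))"
proof (induction k arbitrary: f)
  case 0
  then show ?case using bounded_linear.continuous_on[OF assms(2)] by simp
next
  case (Suc k)
  show ?case
  proof (rule Ck_on_SucI[OF assms(1)])
    show "((\<lambda>x. L (f x)) has_derivative (\<lambda>v. L (frechet_derivative f (at x) v))) (at x)" if "x \<in> U" for x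
      using bounded_linear.has_derivative[OF assms(2) Ck_on_Suc_has_derivative[OF Suc.prems that]] .
    show "Ck_on k U (\<lambda>x. L (frechet_derivative f (at x) v))" for v
      using Suc by simp
  qed
qed

lemma Ck_on_add:
  assumes "open U" shows "Ck_on k U f \<Longrightarrow> Ck_on k U g \<Longrightarrow> Ck_on k U (\<lambda>x. f x + g x)"
proof (induction k arbitrary: f g)
  case (Suc k)
  show ?case
  proof (rule Ck_on_SucI[OF assms])
    show "((\<lambda>x. f x + g x) has_derivative
        (\<lambda>v. frechet_derivative f (at x) v + frechet_derivative g (at x) v)) (at x)" if "x \<in> U" for x
      by (intro has_derivative_add Ck_on_Suc_has_derivative[OF Suc.prems(1) that]
          Ck_on_Suc_has_derivative[OF Suc.prems(2) that])
  qed (use Suc in simp)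
qed (auto intro: continuous_on_add)

lemma Ck_on_sum:
  assumes "open U" "\<And>i. i \<in> I \<Longrightarrow> Ck_on k U (f i)" shows "Ck_on k U (\<lambda>x. \<Sum>i\<in>I. f i x)"
  using assms(2) by (induction I rule: infinite_finite_induct) (auto simp: Ck_on_const Ck_on_add[OF assms(1)])

lemma Ck_on_scaleR:
  assumes "open U"
  shows "Ck_on k U f \<Longrightarrow> Ck_on k U g \<Longrightarrow> Ck_on k U (\<lambda>x. (f x :: real) *\<^sub>R g x)"
proof (induction k arbitrary: f g)
  case (Suc k)
  show ?case
  proof (rule Ck_on_SucI[OF assms])
    show "((\<lambda>x. f x *\<^sub>R g x) has_derivative
        (\<lambda>v. f x *\<^sub>R frechet_derivative g (at x) v + frechet_derivative f (at x) v *\<^sub>R g x)) (at x)" if "x \<in> U" for x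
      by (intro has_derivative_scaleR Ck_on_Suc_has_derivative[OF Suc.prems(1) that]
          Ck_on_Suc_has_derivative[OF Suc.prems(2) that])
    show "Ck_on k U (\<lambda>x. f x *\<^sub>R frechet_derivative g (at x) v + frechet_derivative f (at x) v *\<^sub>R g x)" for v
      using Suc.prems by (intro Ck_on_add[OF assms] Suc.IH) (auto intro: Ck_on_Suc_imp)
  qed
qed (auto intro: continuous_on_scaleR)

lemma linear_basis_expand:
  fixes L :: "'a::euclidean_space \<Rightarrow> 'b::real_vector"
  assumes lin: "linear L" shows "L v = (\<Sum>b\<in>Basis. (v \<bullet> b) *\<^sub>R L b)"
proof -
  have "L v = L (\<Sum>b\<in>Basis. (v \<bullet> b) *\<^sub>R b)"
    by (subst euclidean_representation) (rule refl)
  also have "\<dots> = (\<Sum>b\<in>Basis. L ((v \<bullet> b) *\<^sub>R b))"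
    by (rule linear_sum[OF lin])
  also have "\<dots> = (\<Sum>b\<in>Basis. (v \<bullet> b) *\<^sub>R L b)"
    by (rule sum.cong[OF refl], rule linear_scale[OF lin])
  finally show ?thesis .
qed

text \<open>
  The chain rule writes \<open>D(g \<circ> f)\<close> in terms of the partial derivatives of \<open>g\<close> composed with \<open>f\<close>
  and of the components of \<open>Df\<close>.  Finite dimension of the domain of \<open>g\<close>
  enters here: the derivative of \<open>g\<close> is a finite combination of its values on fixed vectors.
\<close>
lemma Ck_on_compose:
  fixes g :: "'a::euclidean_space \<Rightarrow> 'b::real_normed_vector"
  assumes "open U" "f ` U \<subseteq> V"
  shows "Ck_on k U f \<Longrightarrow> Ck_on k V g \<Longrightarrow> Ck_on k U (\<lambda>x. g (f x))"
proof (induction k arbitrary: g)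
  case 0
  then show ?case using continuous_on_compose2[of V g U f] assms(2) by simp
next
  case (Suc k)
  define g' where "g' y = frechet_derivative g (at y)" for y
  have g': "(g has_derivative g' y) (at y)" if "y \<in> V" for y
    using Ck_on_Suc_has_derivative[OF Suc.prems(2) that] by (simp add: g'_def)
  show ?case
  proof (rule Ck_on_SucI[OF assms(1)])
    fix x assume x: "x \<in> U"
    then have fx: "f x \<in> V" using assms(2) by blast
    have "((\<lambda>x. g (f x)) has_derivative (\<lambda>v. g' (f x) (frechet_derivative f (at x) v))) (at x)"
      using diff_chain_at[OF Ck_on_Suc_has_derivative[OF Suc.prems(1) x] g'[OF fx]] by (simp only: o_def)
    then show "((\<lambda>x. g (f x)) has_derivative
        (\<lambda>v. \<Sum>b\<in>Basis. (frechet_derivative f (at x) v \<bullet> b) *\<^sub>R g' (f x) b)) (at x)"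
      by (rule has_derivative_eq_rhs)
        (rule ext, rule linear_basis_expand[OF has_derivative_linear[OF g'[OF fx]]])
  next
    fix v
    have "Ck_on k U (\<lambda>x. g' (f x) b)" for b
      unfolding g'_def using Suc.prems(2) by (intro Suc.IH Ck_on_Suc_imp[OF Suc.prems(1)]) simp
    moreover have "Ck_on k U (\<lambda>x. frechet_derivative f (at x) v \<bullet> b)" for b
      using Suc.prems(1) by (intro Ck_on_bounded_linear[OF assms(1) bounded_linear_inner_left]) simp
    ultimately show "Ck_on k U (\<lambda>x. \<Sum>b\<in>Basis. (frechet_derivative f (at x) v \<bullet> b) *\<^sub>R g' (f x) b)"
      by (intro Ck_on_sum[OF assms(1)] Ck_on_scaleR[OF assms(1)])
  qed
qed

lemma smooth_on_cong:
  "open U \<Longrightarrow> smooth_on U f \<Longrightarrow> (\<And>x. x \<in> U \<Longrightarrow> f x = g x) \<Longrightarrow> smooth_on U g"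
  by (simp add: smooth_on_def Ck_on_cong[of U _ f g])

lemma smooth_on_subset: "smooth_on U f \<Longrightarrow> V \<subseteq> U \<Longrightarrow> smooth_on V f"
  unfolding smooth_on_def using Ck_on_subset by blast

lemma smooth_on_const: "smooth_on U (\<lambda>x. c)"
  by (simp add: smooth_on_def Ck_on_const)

lemma smooth_on_ident: "smooth_on U (\<lambda>x. x)"
  by (simp add: smooth_on_def Ck_on_ident)

lemma smooth_on_bounded_linear:
  "open U \<Longrightarrow> bounded_linear L \<Longrightarrow> smooth_on U f \<Longrightarrow> smooth_on U (\<lambda>x. L (f x))"
  by (simp add: smooth_on_def Ck_on_bounded_linear)

lemma smooth_on_compose:
  fixes g :: "'a::euclidean_space \<Rightarrow> 'b::real_normed_vector"
  shows "open U \<Longrightarrow> smooth_on U f \<Longrightarrow> smooth_on V g \<Longrightarrow> f ` U \<subseteq> V \<Longrightarrow> smooth_on U (\<lambda>x. g (f x))"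
  by (simp add: smooth_on_def Ck_on_compose)

lemma smooth_on_Pair:
  assumes "open U" "smooth_on U f" "smooth_on U g" shows "smooth_on U (\<lambda>x. (f x, g x))"
proof -
  have "bounded_linear (\<lambda>a::'b. (a, 0::'c))" "bounded_linear (\<lambda>b::'c. (0::'b, b))"
    by (intro bounded_linear_Pair bounded_linear_ident bounded_linear_zero)+
  note L = this
  have "Ck_on k U (\<lambda>x. (f x, 0) + (0, g x))" for k
  proof (rule Ck_on_add[OF assms(1)])
    show "Ck_on k U (\<lambda>x. (f x, 0::'c))" "Ck_on k U (\<lambda>x. (0::'b, g x))"
      using Ck_on_bounded_linear[OF assms(1) L(1), of k f] Ck_on_bounded_linear[OF assms(1) L(2), of k g] assms(2,3)
      by (simp_all add: smooth_on_def)
  qed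
  then show ?thesis by (simp add: smooth_on_def)
qed

lemma smooth_on_has_derivative:
  "smooth_on U f \<Longrightarrow> x \<in> U \<Longrightarrow> (f has_derivative frechet_derivative f (at x)) (at x)"
  unfolding smooth_on_def by (rule Ck_on_Suc_has_derivative[of 0]) blast+

lemma smooth_on_frechet_derivative:
  assumes "smooth_on U f" shows "smooth_on U (\<lambda>x. frechet_derivative f (at x) v)"
proof -
  have "Ck_on (Suc k) U f" for k using assms unfolding smooth_on_def by blast
  then show ?thesis by (simp add: smooth_on_def)
qed

lemma smooth_on_linear_frechet_derivative:
  "smooth_on U f \<Longrightarrow> x \<in> U \<Longrightarrow> linear (frechet_derivative f (at x))"
  by (rule has_derivative_linear[OF smooth_on_has_derivative])

text \<open>
  Both the base point and the direction of a derivative may vary smoothly.  All vector fields and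
  coordinate changes below are of this form.
\<close>
lemma smooth_on_derivative_apply:
  fixes f :: "'a::euclidean_space \<Rightarrow> 'b::real_normed_vector"
  assumes "open U" "smooth_on V f" "smooth_on U p" "smooth_on U g" "p ` U \<subseteq> V"
  shows "smooth_on U (\<lambda>x. frechet_derivative f (at (p x)) (g x))"
proof -
  have D: "smooth_on U (\<lambda>x. frechet_derivative f (at (p x)) b)" for b
    using smooth_on_compose[OF assms(1,3) smooth_on_frechet_derivative[OF assms(2)] assms(5)] .
  have "smooth_on U (\<lambda>x. \<Sum>b\<in>Basis. (g x \<bullet> b) *\<^sub>R frechet_derivative f (at (p x)) b)"
    unfolding smooth_on_def
  proof (rule allI, rule Ck_on_sum[OF assms(1)], rule Ck_on_scaleR[OF assms(1)])
    fix k and b :: 'a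
    show "Ck_on k U (\<lambda>x. g x \<bullet> b)"
      using smooth_on_bounded_linear[OF assms(1) bounded_linear_inner_left assms(4)] by (simp add: smooth_on_def)
    show "Ck_on k U (\<lambda>x. frechet_derivative f (at (p x)) b)" using D by (simp add: smooth_on_def)
  qed
  then show ?thesis
  proof (rule smooth_on_cong[OF assms(1)])
    fix x assume "x \<in> U"
    then have "linear (frechet_derivative f (at (p x)))"
      by (intro smooth_on_linear_frechet_derivative[OF assms(2)]) (use assms(5) in blast)
    from linear_basis_expand[OF this, of "g x"]
    show "(\<Sum>b\<in>Basis. (g x \<bullet> b) *\<^sub>R frechet_derivative f (at (p x)) b) = frechet_derivative f (at (p x)) (g x)" ..
  qed
qed

text \<open>
  Applying the mean value theorem first in the direction \<open>a\<close> and then in the direction \<open>b\<close> turns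
  the second difference of \<open>f\<close> over a small parallelogram into a mixed derivative at a nearby point.
\<close>
lemma double_difference_mean_value:
  fixes f :: "'a::real_normed_vector \<Rightarrow> real"
  assumes f: "Ck_on 2 (ball x r) f" and t: "0 < t" "t * (norm a + norm b) < r"
  obtains y where "y \<in> ball x r" "dist y x \<le> t * (norm a + norm b)"
    "f (x + t *\<^sub>R a + t *\<^sub>R b) - f (x + t *\<^sub>R a) - f (x + t *\<^sub>R b) + f x
      = t * t * frechet_derivative (\<lambda>z. frechet_derivative f (at z) a) (at y) b"
proof -
  define f' where "f' z = frechet_derivative f (at z)" for z
  define f'' where "f'' z = frechet_derivative (\<lambda>z. f' z a) (at z)" for z
  have f1: "(f has_derivative f' z) (at z)" and f2: "((\<lambda>z. f' z a) has_derivative f'' z) (at z)"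
    if "z \<in> ball x r" for z
    using f that unfolding f'_def f''_def
    by (simp_all add: numeral_2_eq_2 frechet_derivative_works[symmetric])
  have near: "dist (x + s *\<^sub>R a + u *\<^sub>R b) x \<le> t * (norm a + norm b)" if "0 \<le> s" "s \<le> t" "0 \<le> u" "u \<le> t" for s u
  proof -
    have "dist (x + s *\<^sub>R a + u *\<^sub>R b) x = norm (s *\<^sub>R a + u *\<^sub>R b)" by (simp add: dist_norm)
    also have "\<dots> \<le> norm (s *\<^sub>R a) + norm (u *\<^sub>R b)" by (rule norm_triangle_ineq)
    also have "\<dots> \<le> t * norm a + t * norm b" using that by (auto intro!: add_mono mult_right_mono)
    finally show ?thesis by (simp add: distrib_left)
  qed
  have inb: "x + s *\<^sub>R a + u *\<^sub>R b \<in> ball x r" if "0 \<le> s" "s \<le> t" "0 \<le> u" "u \<le> t" for s u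
    using near[OF that] t by (simp add: dist_commute)
  define p where "p s = f (x + s *\<^sub>R a + t *\<^sub>R b) - f (x + s *\<^sub>R a)" for s
  have line: "((\<lambda>s. q + s *\<^sub>R w) has_derivative (\<lambda>k. k *\<^sub>R w)) (at s)" for q w :: 'a and s :: real
    by (auto intro!: derivative_eq_intros)
  have along: "((\<lambda>s. g (q + s *\<^sub>R w)) has_real_derivative g' w) (at s)"
    if g: "(g has_derivative g') (at (q + s *\<^sub>R w))" for g :: "'a \<Rightarrow> real" and g' q w s
  proof -
    have "((g \<circ> (\<lambda>s. q + s *\<^sub>R w)) has_derivative g' \<circ> (\<lambda>k. k *\<^sub>R w)) (at s)"
      by (rule diff_chain_at[OF line g])
    moreover have "g' (k *\<^sub>R w) = g' w * k" for k
      using linear_scale[OF has_derivative_linear[OF g]] by simp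
    ultimately show ?thesis by (simp add: has_field_derivative_def o_def)
  qed
  have p': "(p has_real_derivative f' (x + s *\<^sub>R a + t *\<^sub>R b) a - f' (x + s *\<^sub>R a) a) (at s)" if "0 \<le> s" "s \<le> t" for s
  proof -
    have "((\<lambda>s. f (x + t *\<^sub>R b + s *\<^sub>R a)) has_real_derivative f' (x + t *\<^sub>R b + s *\<^sub>R a) a) (at s)"
      using f1[OF inb[of s t]] that t by (intro along) (simp add: add_ac)
    moreover have "((\<lambda>s. f (x + s *\<^sub>R a)) has_real_derivative f' (x + s *\<^sub>R a) a) (at s)"
      using f1[OF inb[of s 0]] that t by (intro along) simp
    ultimately show ?thesis unfolding p_def by (auto simp: add_ac intro: DERIV_diff)
  qed
  obtain s where s: "0 < s" "s < t" "p t - p 0 = (t - 0) * (f' (x + s *\<^sub>R a + t *\<^sub>R b) a - f' (x + s *\<^sub>R a) a)"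
    using MVT2[OF t(1) p'] by blast
  have "((\<lambda>u. f' (x + s *\<^sub>R a + u *\<^sub>R b) a) has_real_derivative f'' (x + s *\<^sub>R a + u *\<^sub>R b) b) (at u)"
    if "0 \<le> u" "u \<le> t" for u
    using f2[OF inb[of s u]] that s by (intro along) auto
  from MVT2[OF t(1) this] obtain u where u: "0 < u" "u < t"
    "f' (x + s *\<^sub>R a + t *\<^sub>R b) a - f' (x + s *\<^sub>R a) a = t * f'' (x + s *\<^sub>R a + u *\<^sub>R b) b"
    by auto
  show thesis
  proof
    show "x + s *\<^sub>R a + u *\<^sub>R b \<in> ball x r" "dist (x + s *\<^sub>R a + u *\<^sub>R b) x \<le> t * (norm a + norm b)"
      using inb[of s u] near[of s u] s u by auto
    show "f (x + t *\<^sub>R a + t *\<^sub>R b) - f (x + t *\<^sub>R a) - f (x + t *\<^sub>R b) + f x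
      = t * t * frechet_derivative (\<lambda>z. frechet_derivative f (at z) a) (at (x + s *\<^sub>R a + u *\<^sub>R b)) b"
      using s(3) u(3) by (simp add: p_def f'_def f''_def)
  qed
qed

text \<open>
  The second difference of \<open>f\<close> is symmetric in \<open>a\<close> and \<open>b\<close>, so the two mixed derivatives agree
  at points arbitrarily close to \<open>x\<close>, hence at \<open>x\<close> by continuity.
\<close>
lemma second_derivative_symmetric_real:
  fixes f :: "'a::real_normed_vector \<Rightarrow> real"
  assumes "open U" "x \<in> U" and f: "Ck_on 2 U f"
  shows "frechet_derivative (\<lambda>z. frechet_derivative f (at z) a) (at x) b
       = frechet_derivative (\<lambda>z. frechet_derivative f (at z) b) (at x) a"
proof -
  define A where "A a b y = frechet_derivative (\<lambda>z. frechet_derivative f (at z) a) (at y) b" for a b y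
  have cont: "isCont (A a b) x" for a b
  proof -
    have "continuous_on U (A a b)" using f by (simp add: numeral_2_eq_2 A_def)
    then show ?thesis using assms(1,2) by (simp add: continuous_on_eq_continuous_at)
  qed
  obtain r where r: "r > 0" "ball x r \<subseteq> U" using assms(1,2) openE by blast
  have f': "Ck_on 2 (ball x r) f" using Ck_on_subset[OF f r(2)] .
  have "\<bar>A a b x - A b a x\<bar> \<le> \<epsilon>" if "\<epsilon> > 0" for \<epsilon>
  proof -
    have "\<exists>d>0. \<forall>y. dist y x < d \<longrightarrow> dist (A a b y) (A a b x) < \<epsilon> / 2" for a b
      using cont[of a b] half_gt_zero[OF that] unfolding continuous_at_eps_delta by blast
    then obtain d1 d2 where d: "d1 > 0" "d2 > 0"
      "\<And>y. dist y x < d1 \<Longrightarrow> dist (A a b y) (A a b x) < \<epsilon> / 2"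
      "\<And>y. dist y x < d2 \<Longrightarrow> dist (A b a y) (A b a x) < \<epsilon> / 2" by metis
    \<comment> \<open>The summand 1 only keeps the denominator of \<open>t\<close> positive.\<close>
    define N where "N = norm a + norm b + 1"
    define t where "t = min r (min d1 d2) / (2 * N)"
    have N: "N > 0" unfolding N_def by (intro add_nonneg_pos add_nonneg_nonneg) auto
    then have t: "t > 0" using r d by (simp add: t_def)
    have "t * (norm a + norm b) \<le> t * N" using t by (simp add: N_def)
    also have "t * N < min r (min d1 d2)" using N r d by (simp add: t_def field_simps min_def)
    finally have small: "t * (norm a + norm b) < min r (min d1 d2)" .
    obtain y where y: "dist y x \<le> t * (norm a + norm b)"
      "f (x + t *\<^sub>R a + t *\<^sub>R b) - f (x + t *\<^sub>R a) - f (x + t *\<^sub>R b) + f x = t * t * A a b y"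
      using double_difference_mean_value[OF f' t, of a b] small unfolding A_def by auto
    obtain z where z: "dist z x \<le> t * (norm b + norm a)"
      "f (x + t *\<^sub>R b + t *\<^sub>R a) - f (x + t *\<^sub>R b) - f (x + t *\<^sub>R a) + f x = t * t * A b a z"
      using double_difference_mean_value[OF f' t, of b a] small unfolding A_def by (auto simp: add.commute)
    have "x + t *\<^sub>R b + t *\<^sub>R a = x + t *\<^sub>R a + t *\<^sub>R b" by (simp add: add_ac)
    then have "t * t * A a b y = t * t * A b a z" using y(2) z(2) by (simp only:)
    then have "A a b y = A b a z" using t by simp
    moreover have "dist (A a b y) (A a b x) < \<epsilon> / 2" "dist (A b a z) (A b a x) < \<epsilon> / 2"
      using d(3)[of y] d(4)[of z] y(1) z(1) small by (auto simp: add.commute)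
    ultimately show ?thesis unfolding dist_real_def by linarith
  qed
  then have "A a b x = A b a x" using field_le_epsilon[of "\<bar>A a b x - A b a x\<bar>" 0] by auto
  then show ?thesis by (simp add: A_def)
qed

lemma second_derivative_symmetric:
  fixes f :: "'a::real_normed_vector \<Rightarrow> 'b::euclidean_space"
  assumes U: "open U" "x \<in> U" and f: "smooth_on U f"
  shows "frechet_derivative (\<lambda>z. frechet_derivative f (at z) a) (at x) b
       = frechet_derivative (\<lambda>z. frechet_derivative f (at z) b) (at x) a"
proof (rule euclidean_eqI)
  fix i :: 'b
  have f': "((\<lambda>z. f z \<bullet> i) has_derivative (\<lambda>v. frechet_derivative f (at z) v \<bullet> i)) (at z)" if "z \<in> U" for z
    using smooth_on_has_derivative[OF f that] by (auto intro!: derivative_eq_intros)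
  have "frechet_derivative (\<lambda>z. frechet_derivative (\<lambda>z. f z \<bullet> i) (at z) a) (at x) b
      = frechet_derivative (\<lambda>z. frechet_derivative f (at z) a) (at x) b \<bullet> i" for a b
  proof -
    have "((\<lambda>z. frechet_derivative f (at z) a \<bullet> i) has_derivative
        (\<lambda>v. frechet_derivative (\<lambda>z. frechet_derivative f (at z) a) (at x) v \<bullet> i)) (at x)"
      using smooth_on_has_derivative[OF smooth_on_frechet_derivative[OF f] U(2)]
      by (auto intro!: derivative_eq_intros)
    then have "((\<lambda>z. frechet_derivative (\<lambda>z. f z \<bullet> i) (at z) a) has_derivative
        (\<lambda>v. frechet_derivative (\<lambda>z. frechet_derivative f (at z) a) (at x) v \<bullet> i)) (at x)"
      using U by (rule has_derivative_transform_within_open) (simp add: frechet_derivative_eqI[OF f'])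
    then show ?thesis by (simp add: frechet_derivative_eqI)
  qed
  moreover have "Ck_on 2 U (\<lambda>z. f z \<bullet> i)"
    using smooth_on_bounded_linear[OF U(1) bounded_linear_inner_left f] by (simp add: smooth_on_def)
  ultimately show "frechet_derivative (\<lambda>z. frechet_derivative f (at z) a) (at x) b \<bullet> i
      = frechet_derivative (\<lambda>z. frechet_derivative f (at z) b) (at x) a \<bullet> i"
    using second_derivative_symmetric_real[OF U] by metis
qed

text \<open>
  The product rule for \<open>z \<mapsto> Df(z) (X z)\<close>.  Its second-order term is symmetric in \<open>X x\<close> and \<open>a\<close>,
  which makes it cancel in the transformation law of Lie brackets.
\<close>
lemma has_derivative_pushforward:
  fixes f :: "'a::euclidean_space \<Rightarrow> 'a"
  assumes U: "open U" "x \<in> U" and f: "smooth_on U f" and X: "(X has_derivative X') (at x)"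
  shows "((\<lambda>z. frechet_derivative f (at z) (X z)) has_derivative
    (\<lambda>a. frechet_derivative (\<lambda>z. frechet_derivative f (at z) (X x)) (at x) a
       + frechet_derivative f (at x) (X' a))) (at x)"
proof -
  define f' where "f' z = frechet_derivative f (at z)" for z
  define f'' where "f'' v = frechet_derivative (\<lambda>z. f' z v) (at x)" for v
  have lin: "linear (f' z)" if "z \<in> U" for z
    unfolding f'_def by (rule smooth_on_linear_frechet_derivative[OF f that])
  have f'': "((\<lambda>z. f' z v) has_derivative f'' v) (at x)" for v
    unfolding f''_def f'_def by (rule smooth_on_has_derivative[OF smooth_on_frechet_derivative[OF f] U(2)])
  have sym: "f'' v a = f'' a v" for v a
    unfolding f''_def f'_def by (rule second_derivative_symmetric[OF U f])
  have "((\<lambda>z. \<Sum>b\<in>Basis. (X z \<bullet> b) *\<^sub>R f' z b) has_derivative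
      (\<lambda>a. \<Sum>b\<in>Basis. (X x \<bullet> b) *\<^sub>R f'' b a + (X' a \<bullet> b) *\<^sub>R f' x b)) (at x)"
  proof (rule has_derivative_sum)
    fix b :: 'a
    show "((\<lambda>z. (X z \<bullet> b) *\<^sub>R f' z b) has_derivative
        (\<lambda>a. (X x \<bullet> b) *\<^sub>R f'' b a + (X' a \<bullet> b) *\<^sub>R f' x b)) (at x)"
      by (rule has_derivative_scaleR[OF has_derivative_inner_left[OF X] f''])
  qed
  then have "((\<lambda>z. f' z (X z)) has_derivative
      (\<lambda>a. \<Sum>b\<in>Basis. (X x \<bullet> b) *\<^sub>R f'' b a + (X' a \<bullet> b) *\<^sub>R f' x b)) (at x)"
  proof (rule has_derivative_transform_within_open[OF _ U])
    fix z assume "z \<in> U"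
    show "(\<Sum>b\<in>Basis. (X z \<bullet> b) *\<^sub>R f' z b) = f' z (X z)"
      by (rule linear_basis_expand[OF lin[OF \<open>z \<in> U\<close>], symmetric])
  qed
  then show ?thesis
    unfolding f'_def[symmetric] f''_def[symmetric]
  proof (rule has_derivative_eq_rhs)
    have "(\<Sum>b\<in>Basis. (X x \<bullet> b) *\<^sub>R f'' b a) = f'' (X x) a" for a
    proof -
      have "f'' a (X x) = (\<Sum>b\<in>Basis. (X x \<bullet> b) *\<^sub>R f'' a b)"
        by (rule linear_basis_expand[OF has_derivative_linear[OF f'']])
      then show ?thesis by (simp only: sym[of a])
    qed
    moreover have "(\<Sum>b\<in>Basis. (X' a \<bullet> b) *\<^sub>R f' x b) = f' x (X' a)" for a
      by (rule linear_basis_expand[OF lin[OF U(2)], symmetric])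
    ultimately show "(\<lambda>a. \<Sum>b\<in>Basis. (X x \<bullet> b) *\<^sub>R f'' b a + (X' a \<bullet> b) *\<^sub>R f' x b)
        = (\<lambda>a. f'' (X x) a + f' x (X' a))"
      by (simp only: sum.distrib)
  qed
qed

section \<open>Families of vectors and dimensions\<close>

lemma sum_fun_apply: "(\<Sum>i\<in>I. F i) x = (\<Sum>i\<in>I. F i x)"
  by (induction I rule: infinite_finite_induct) auto

text \<open>
  The list of vectors in \<open>is_basis\<close> is turned into a set, so both distinctness and independence
  have to be extracted from the vanishing of coefficients.
\<close>
lemma independent_family:
  fixes w :: "'i \<Rightarrow> 'v::real_vector"
  assumes fin: "finite I" and zero: "\<And>c i. (\<Sum>i\<in>I. c i *\<^sub>R w i) = 0 \<Longrightarrow> i \<in> I \<Longrightarrow> c i = 0"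
  shows "inj_on w I" and "independent (w ` I)"
proof -
  show inj: "inj_on w I"
  proof (rule inj_onI, rule ccontr)
    fix i j assume ij: "i \<in> I" "j \<in> I" "w i = w j" "i \<noteq> j"
    define c :: "'i \<Rightarrow> real" where "c k = (if k = i then 1 else 0) - (if k = j then 1 else 0)" for k
    have "(\<Sum>k\<in>I. c k *\<^sub>R w k) = w i - w j"
      using ij(1,2) fin by (simp add: c_def scaleR_left_diff_distrib sum_subtractf if_distrib[of "\<lambda>r. r *\<^sub>R _"] cong: if_cong)
    then have "c i = 0" using zero[of c i] ij by simp
    then show False using ij(4) by (simp add: c_def)
  qed
  show "independent (w ` I)"
  proof (rule independent_if_scalars_zero)
    fix f x assume s: "(\<Sum>x\<in>w ` I. f x *\<^sub>R x) = 0" and "x \<in> w ` I"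
    then obtain i where "i \<in> I" "x = w i" by blast
    moreover have "(\<Sum>i\<in>I. f (w i) *\<^sub>R w i) = 0" using s by (simp add: sum.reindex[OF inj])
    ultimately show "f x = 0" using zero[of "\<lambda>i. f (w i)" i] by simp
  qed (use fin in simp)
qed

text \<open>
  The ambient spaces of functions have infinite dimension, so the dimension formula of
  finite-dimensional spaces does not apply to them.
\<close>
lemma dim_linear_image:
  assumes "linear f" "subspace S" "inj_on f S"
  shows "dim (f ` S) = dim S"
proof -
  obtain B where B: "B \<subseteq> S" "independent B" "S \<subseteq> span B" "card B = dim S"
    by (rule basis_exists)
  have sp: "span B = S" using B(1,3) assms(2) by (simp add: span_subspace)
  have "independent (f ` B)"
    using linear_independent_injective_image[OF assms(1) B(2)] assms(3) sp by blast
  moreover have "span (f ` B) = f ` S" using linear_span_image[OF assms(1)] sp by metis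
  moreover have "card (f ` B) = card B" using assms(3) B(1) by (meson card_image inj_on_subset)
  ultimately show ?thesis using B(4) by (metis dim_span_eq_card_independent)
qed

definition supported_on :: "'i set \<Rightarrow> ('i \<Rightarrow> real) set" where
  "supported_on I = {g. \<forall>x. x \<notin> I \<longrightarrow> g x = 0}"

text \<open>
  Every dimension in this development is computed by identifying a space of tensors with such a
  space of arrays.
\<close>
lemma dim_supported_on:
  assumes "finite I" shows "dim (supported_on I) = card I"
proof -
  define w :: "'a \<Rightarrow> 'a \<Rightarrow> real" where "w i = (\<lambda>x. if x = i then 1 else 0)" for i
  have expand: "(\<Sum>i\<in>I. c i *\<^sub>R w i) x = (if x \<in> I then c x else 0)" for c x
    using assms by (simp add: sum_fun_apply scaleR_fun_def w_def if_distrib[of "\<lambda>r. _ * r"] cong: if_cong)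
  have fam: "inj_on w I" "independent (w ` I)"
  proof -
    have z: "c i = 0" if "(\<Sum>i\<in>I. c i *\<^sub>R w i) = 0" "i \<in> I" for c i
      using expand[of c i] that by simp
    show "inj_on w I" by (rule independent_family[OF assms]) (rule z)
    show "independent (w ` I)" by (rule independent_family[OF assms]) (rule z)
  qed
  show ?thesis
  proof (rule dim_unique)
    show "w ` I \<subseteq> supported_on I" by (auto simp: w_def supported_on_def)
    show "supported_on I \<subseteq> span (w ` I)"
    proof
      fix g assume "g \<in> supported_on I"
      then have "g = (\<Sum>i\<in>I. g i *\<^sub>R w i)" by (auto simp: fun_eq_iff expand supported_on_def)
      then show "g \<in> span (w ` I)" by (metis (no_types, lifting) span_sum span_scale span_base imageI)
    qed
  qed (use fam in \<open>auto simp: card_image\<close>)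
qed

lemma hom_on_sum:
  assumes T: "subspace T" and f: "f \<in> hom_on T E" and x: "\<And>i. i \<in> I \<Longrightarrow> x i \<in> T"
  shows "f (\<Sum>i\<in>I. c i *\<^sub>R x i) = (\<Sum>i\<in>I. c i *\<^sub>R f (x i))"
proof -
  have "f 0 = 0"
  proof -
    have "f (0 *\<^sub>R 0) = 0 *\<^sub>R f 0" using f subspace_0[OF T] unfolding hom_on_def by blast
    then show ?thesis by simp
  qed
  then show ?thesis using x
  proof (induction I rule: infinite_finite_induct)
    case (insert i I)
    have "(\<Sum>i\<in>I. c i *\<^sub>R x i) \<in> T" using insert T by (intro subspace_sum subspace_scale) auto
    moreover have "c i *\<^sub>R x i \<in> T" "x i \<in> T" using insert T by (auto intro: subspace_scale)
    ultimately have "f (c i *\<^sub>R x i + (\<Sum>i\<in>I. c i *\<^sub>R x i)) = c i *\<^sub>R f (x i) + f (\<Sum>i\<in>I. c i *\<^sub>R x i)"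
      using f unfolding hom_on_def by simp
    with insert show ?case by simp
  qed auto
qed

lemma subspace_hom_on:
  assumes "subspace E" shows "subspace (hom_on T E)"
  using assms unfolding subspace_def hom_on_def
  by (auto simp: scaleR_fun_def algebra_simps)

section \<open>The symbol and its prolongation in an adapted frame\<close>

text \<open>
  All the data that the symbol uses at one point: the tangent space \<open>T\<close>, a horizontal frame \<open>H\<close> and
  a vertical frame \<open>v\<close> of \<open>m + 1\<close> vectors each, the dual coordinates \<open>\<alpha>\<close> and \<open>\<beta>\<close>, and the
  endomorphisms \<open>J\<close> and \<open>h\<close>, which map \<open>H i\<close> to \<open>v i\<close> and \<open>H i\<close> and annihilate the vertical
  vectors.  The last vertical vector is the Liouville vector, so that the equation \<open>i\<^sub>C A = 0\<close> removes
  one index.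
\<close>
locale adapted_frame =
  fixes T :: "'v::real_vector set" and J h :: "'v \<Rightarrow> 'v" and C :: 'v and m :: nat
    and H v :: "nat \<Rightarrow> 'v" and \<alpha> \<beta> :: "nat \<Rightarrow> 'v \<Rightarrow> real"
  assumes T: "subspace T"
    and lin_\<alpha>: "linear (\<alpha> i)" and lin_\<beta>: "linear (\<beta> i)"
    and H_T [simp]: "i \<le> m \<Longrightarrow> H i \<in> T" and v_T [simp]: "i \<le> m \<Longrightarrow> v i \<in> T"
    and dual_\<alpha>H [simp]: "i \<le> m \<Longrightarrow> j \<le> m \<Longrightarrow> \<alpha> i (H j) = (if i = j then 1 else 0)"
    and dual_\<alpha>v [simp]: "i \<le> m \<Longrightarrow> j \<le> m \<Longrightarrow> \<alpha> i (v j) = 0"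
    and dual_\<beta>H [simp]: "i \<le> m \<Longrightarrow> j \<le> m \<Longrightarrow> \<beta> i (H j) = 0"
    and dual_\<beta>v [simp]: "i \<le> m \<Longrightarrow> j \<le> m \<Longrightarrow> \<beta> i (v j) = (if i = j then 1 else 0)"
    and expand: "X \<in> T \<Longrightarrow> X = (\<Sum>i\<le>m. \<alpha> i X *\<^sub>R H i) + (\<Sum>i\<le>m. \<beta> i X *\<^sub>R v i)"
    and J_expand: "X \<in> T \<Longrightarrow> J X = (\<Sum>i\<le>m. \<alpha> i X *\<^sub>R v i)"
    and h_expand: "X \<in> T \<Longrightarrow> h X = (\<Sum>i\<le>m. \<alpha> i X *\<^sub>R H i)"
    and C_eq: "C = v m"
begin

text \<open>
  The vertical vectors are those whose horizontal coordinates vanish.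
\<close>
definition semibasic :: "('v \<Rightarrow> real) set" where
  "semibasic = {\<theta> \<in> hom_on T UNIV. \<forall>X\<in>T. (\<forall>i\<le>m. \<alpha> i X = 0) \<longrightarrow> \<theta> X = 0}"

abbreviation tau_on :: "('v \<Rightarrow> 'v) \<Rightarrow> ('v \<Rightarrow> 'v \<Rightarrow> real) \<Rightarrow> 'v \<Rightarrow> 'v \<Rightarrow> real" where
  "tau_on L A \<equiv> (\<lambda>X Y. if X \<in> T \<and> Y \<in> T then A (L X) Y - A (L Y) X else 0)"

definition G1 :: "('v \<Rightarrow> 'v \<Rightarrow> real) set" where
  "G1 = {A \<in> hom_on T semibasic. A C = 0 \<and> tau_on J A = 0 \<and> tau_on h A = 0}"

definition G2 :: "('v \<Rightarrow> 'v \<Rightarrow> 'v \<Rightarrow> real) set" where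
  "G2 = {B \<in> hom_on T (hom_on T semibasic). (\<forall>X\<in>T. \<forall>Y\<in>T. B X Y = B Y X) \<and> (\<forall>X\<in>T. B X \<in> G1)}"

lemmas T_simps [simp] = subspace_add[OF T] subspace_scale[OF T] subspace_0[OF T]
lemmas \<alpha>\<beta>_linear = linear_add[OF lin_\<alpha>] linear_add[OF lin_\<beta>] linear_scale[OF lin_\<alpha>] linear_scale[OF lin_\<beta>]

lemma subspace_semibasic: "subspace semibasic"
proof -
  have "subspace (hom_on T (UNIV :: real set))" by (intro subspace_hom_on subspace_UNIV)
  then show ?thesis unfolding semibasic_def subspace_def by (auto simp: scaleR_fun_def)
qed

lemma hom_on_expand:
  assumes "A \<in> hom_on T E" "X \<in> T"
  shows "A X = (\<Sum>i\<le>m. \<alpha> i X *\<^sub>R A (H i)) + (\<Sum>i\<le>m. \<beta> i X *\<^sub>R A (v i))"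
proof -
  have m: "(\<Sum>i\<le>m. \<alpha> i X *\<^sub>R H i) \<in> T" "(\<Sum>i\<le>m. \<beta> i X *\<^sub>R v i) \<in> T"
    by (auto intro!: subspace_sum[OF T])
  have "A X = A ((\<Sum>i\<le>m. \<alpha> i X *\<^sub>R H i) + (\<Sum>i\<le>m. \<beta> i X *\<^sub>R v i))"
    using expand[OF assms(2)] by simp
  also have "\<dots> = A (\<Sum>i\<le>m. \<alpha> i X *\<^sub>R H i) + A (\<Sum>i\<le>m. \<beta> i X *\<^sub>R v i)"
    using assms(1) m unfolding hom_on_def by blast
  also have "A (\<Sum>i\<le>m. \<alpha> i X *\<^sub>R H i) = (\<Sum>i\<le>m. \<alpha> i X *\<^sub>R A (H i))"
    by (intro hom_on_sum[OF T assms(1)]) simp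
  also have "A (\<Sum>i\<le>m. \<beta> i X *\<^sub>R v i) = (\<Sum>i\<le>m. \<beta> i X *\<^sub>R A (v i))"
    by (intro hom_on_sum[OF T assms(1)]) simp
  finally show ?thesis .
qed

lemma semibasic_expand:
  assumes "\<theta> \<in> semibasic" "X \<in> T"
  shows "\<theta> X = (\<Sum>i\<le>m. \<alpha> i X * \<theta> (H i))"
proof -
  have "\<theta> (v i) = 0" if "i \<le> m" for i using assms(1) that by (simp add: semibasic_def)
  then show ?thesis using hom_on_expand[of \<theta> UNIV X] assms by (simp add: semibasic_def)
qed

lemma semibasic_eqI:
  assumes "\<theta> \<in> semibasic" "\<eta> \<in> semibasic" "\<And>j. j \<le> m \<Longrightarrow> \<theta> (H j) = \<eta> (H j)"
  shows "\<theta> = \<eta>"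
proof
  fix X show "\<theta> X = \<eta> X"
  proof (cases "X \<in> T")
    case True
    have "(\<Sum>i\<le>m. \<alpha> i X * \<theta> (H i)) = (\<Sum>i\<le>m. \<alpha> i X * \<eta> (H i))"
      using assms(3) by (intro sum.cong) auto
    then show ?thesis using assms(1,2) True by (simp only: semibasic_expand)
  next
    case False then show ?thesis using assms(1,2) by (simp add: semibasic_def hom_on_def)
  qed
qed

lemma hom_on_eqI:
  assumes "A \<in> hom_on T E" "B \<in> hom_on T E"
    and "\<And>i. i \<le> m \<Longrightarrow> A (H i) = B (H i)" "\<And>i. i \<le> m \<Longrightarrow> A (v i) = B (v i)"
  shows "A = B"
proof
  fix X show "A X = B X"
  proof (cases "X \<in> T")
    case True then show ?thesis using assms(3,4) hom_on_expand[OF assms(1) True] hom_on_expand[OF assms(2) True] by simp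
  next
    case False then show ?thesis using assms(1,2) by (simp add: hom_on_def)
  qed
qed

text \<open>
  A tensor \<open>A\<close> with semi-basic values is determined by the two matrices \<open>A (H i) (H j)\<close> and
  \<open>A (v i) (H j)\<close>.  Evaluating the skew tensors on pairs of horizontal vectors shows that the three
  equations of the symbol say that both matrices are symmetric and that the last row of the second
  one vanishes.
\<close>
lemma G1_iff:
  "A \<in> G1 \<longleftrightarrow> A \<in> hom_on T semibasic \<and> (\<forall>i\<le>m. \<forall>j\<le>m. A (H i) (H j) = A (H j) (H i)) \<and>
    (\<forall>i\<le>m. \<forall>j\<le>m. A (v i) (H j) = A (v j) (H i)) \<and> (\<forall>j\<le>m. A (v m) (H j) = 0)"
proof (cases "A \<in> hom_on T semibasic")
  case A: True
  then have sb: "A X \<in> semibasic" if "X \<in> T" for X using that unfolding hom_on_def by blast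
  have tau: "tau_on L A = 0 \<longleftrightarrow> (\<forall>i\<le>m. \<forall>j\<le>m. A (k i) (H j) = A (k j) (H i))"
    if k: "\<And>i. i \<le> m \<Longrightarrow> k i \<in> T" and L: "\<And>X. X \<in> T \<Longrightarrow> L X = (\<Sum>i\<le>m. \<alpha> i X *\<^sub>R k i)"
    for L :: "'v \<Rightarrow> 'v" and k :: "nat \<Rightarrow> 'v"
  proof
    assume t: "tau_on L A = 0"
    show "\<forall>i\<le>m. \<forall>j\<le>m. A (k i) (H j) = A (k j) (H i)"
    proof (intro allI impI)
      fix i j assume ij: "i \<le> m" "j \<le> m"
      have "L (H i) = k i" if "i \<le> m" for i
        using that by (simp add: L if_distrib[of "\<lambda>r. r *\<^sub>R _"] cong: if_cong)
      with ij fun_cong[OF fun_cong[OF t], of "H i" "H j"] show "A (k i) (H j) = A (k j) (H i)"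
        by simp
    qed
  next
    assume s: "\<forall>i\<le>m. \<forall>j\<le>m. A (k i) (H j) = A (k j) (H i)"
    have e: "A (L X) Y = (\<Sum>i\<le>m. \<Sum>j\<le>m. \<alpha> i X * \<alpha> j Y * A (k i) (H j))" if "X \<in> T" "Y \<in> T" for X Y
    proof -
      have "A (L X) Y = (\<Sum>i\<le>m. \<alpha> i X * A (k i) Y)"
        unfolding L[OF that(1)] using k by (subst hom_on_sum[OF T A]) (simp_all add: sum_fun_apply scaleR_fun_def)
      also have "\<dots> = (\<Sum>i\<le>m. \<alpha> i X * (\<Sum>j\<le>m. \<alpha> j Y * A (k i) (H j)))"
        using that k by (intro sum.cong refl) (simp add: semibasic_expand[OF sb])
      finally show ?thesis by (simp add: sum_distrib_left mult.assoc)
    qed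
    have "A (L X) Y = A (L Y) X" if "X \<in> T" "Y \<in> T" for X Y
    proof -
      have "A (L X) Y = (\<Sum>j\<le>m. \<Sum>i\<le>m. \<alpha> i X * \<alpha> j Y * A (k i) (H j))"
        using e[OF that] by (subst sum.swap) simp
      also have "\<dots> = A (L Y) X"
        unfolding e[OF that(2) that(1)] using s by (intro sum.cong refl) (simp add: mult.commute)
      finally show ?thesis .
    qed
    then show "tau_on L A = 0" by (auto simp: fun_eq_iff)
  qed
  have "A C = 0 \<longleftrightarrow> (\<forall>j\<le>m. A (v m) (H j) = 0)"
    using semibasic_eqI[OF sb subspace_0[OF subspace_semibasic], of "v m"] by (auto simp: C_eq)
  then show ?thesis
    unfolding G1_def using A tau[of v J] tau[of H h] by (auto simp: J_expand h_expand)
qed (simp add: G1_def)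

lemma subspace_G1: "subspace G1"
proof -
  have "subspace (hom_on T semibasic)" by (intro subspace_hom_on subspace_semibasic)
  then show ?thesis unfolding subspace_def Ball_def G1_iff by (auto simp: scaleR_fun_def)
qed

lemma subspace_G2: "subspace G2"
proof -
  have "subspace (hom_on T (hom_on T semibasic))" by (intro subspace_hom_on subspace_semibasic)
  then show ?thesis using subspace_G1 unfolding subspace_def G2_def by (auto simp: scaleR_fun_def)
qed

text \<open>
  Tensors with prescribed components: \<open>a\<close> and \<open>P\<close> are purely horizontal, and each of \<open>w\<close>, \<open>Q\<close>
  and \<open>R\<close> has one more vertical argument than its predecessor.
\<close>
definition form :: "(nat \<Rightarrow> real) \<Rightarrow> 'v \<Rightarrow> real" where
  "form c Y = (if Y \<in> T then \<Sum>j\<le>m. \<alpha> j Y * c j else 0)"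

definition tensor :: "(nat \<Rightarrow> nat \<Rightarrow> real) \<Rightarrow> (nat \<Rightarrow> nat \<Rightarrow> real) \<Rightarrow> 'v \<Rightarrow> 'v \<Rightarrow> real" where
  "tensor a w X = (if X \<in> T then form (\<lambda>j. \<Sum>i\<le>m. \<alpha> i X * a i j + \<beta> i X * w i j) else 0)"

definition tensor2 :: "(nat \<Rightarrow> nat \<Rightarrow> nat \<Rightarrow> real) \<Rightarrow> (nat \<Rightarrow> nat \<Rightarrow> nat \<Rightarrow> real) \<Rightarrow>
    (nat \<Rightarrow> nat \<Rightarrow> nat \<Rightarrow> real) \<Rightarrow> 'v \<Rightarrow> 'v \<Rightarrow> 'v \<Rightarrow> real" where
  "tensor2 P Q R X = (if X \<in> T then tensor
     (\<lambda>j k. \<Sum>i\<le>m. \<alpha> i X * P i j k + \<beta> i X * Q i j k)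
     (\<lambda>j k. \<Sum>i\<le>m. \<alpha> i X * Q i j k + \<beta> i X * R i j k) else 0)"

lemma form_add: "form (\<lambda>j. c j + d j) = form c + form d"
  by (auto simp: form_def fun_eq_iff algebra_simps sum.distrib)

lemma form_scale: "form (\<lambda>j. r * c j) = r *\<^sub>R form c"
  by (auto simp: form_def fun_eq_iff scaleR_fun_def sum_distrib_left mult.left_commute)

lemma form_semibasic: "form c \<in> semibasic"
  unfolding semibasic_def hom_on_def
  by (auto simp: form_def \<alpha>\<beta>_linear algebra_simps sum.distrib sum_distrib_left)

lemma form_H [simp]: "j \<le> m \<Longrightarrow> form c (H j) = c j"
  by (simp add: form_def if_distrib[of "\<lambda>r. r * _"] cong: if_cong)

lemma tensor_add: "tensor (\<lambda>i j. a i j + b i j) (\<lambda>i j. w i j + z i j) = tensor a w + tensor b z"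
  by (auto simp: tensor_def fun_eq_iff form_add[symmetric, THEN fun_cong, simplified] algebra_simps sum.distrib)

lemma tensor_scale: "tensor (\<lambda>i j. r * a i j) (\<lambda>i j. r * w i j) = r *\<^sub>R tensor a w"
proof
  fix X
  have "(\<lambda>j. \<Sum>i\<le>m. \<alpha> i X * (r * a i j) + \<beta> i X * (r * w i j))
      = (\<lambda>j. r * (\<Sum>i\<le>m. \<alpha> i X * a i j + \<beta> i X * w i j))"
    by (simp add: sum_distrib_left algebra_simps)
  then show "tensor (\<lambda>i j. r * a i j) (\<lambda>i j. r * w i j) X = (r *\<^sub>R tensor a w) X"
    by (simp add: tensor_def form_scale scaleR_fun_def[of r "tensor a w"])
qed

lemma tensor_hom: "tensor a w \<in> hom_on T semibasic"
proof -
  have "tensor a w (X + Y) = tensor a w X + tensor a w Y" if "X \<in> T" "Y \<in> T" for X Y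
    using that by (simp add: tensor_def form_add[symmetric] \<alpha>\<beta>_linear algebra_simps sum.distrib)
  moreover have "tensor a w (r *\<^sub>R X) = r *\<^sub>R tensor a w X" if "X \<in> T" for X r
    using that by (simp add: tensor_def form_scale[symmetric] \<alpha>\<beta>_linear algebra_simps sum_distrib_left)
  moreover have "tensor a w X \<in> semibasic" for X
    using form_semibasic subspace_0[OF subspace_semibasic]
    by (cases "X \<in> T") (simp_all only: tensor_def if_True if_False)
  moreover have "tensor a w X = 0" if "X \<notin> T" for X using that by (simp add: tensor_def)
  ultimately show ?thesis unfolding hom_on_def by blast
qed

lemma tensor_frame [simp]:
  assumes "i \<le> m" shows "tensor a w (H i) = form (a i)" "tensor a w (v i) = form (w i)"
  using assms by (simp_all add: tensor_def if_distrib[of "\<lambda>r. r * _"] cong: if_cong)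

lemma tensor2_hom: "tensor2 P Q R \<in> hom_on T (hom_on T semibasic)"
proof -
  have "tensor2 P Q R (X + Y) = tensor2 P Q R X + tensor2 P Q R Y" if "X \<in> T" "Y \<in> T" for X Y
    using that by (simp add: tensor2_def tensor_add[symmetric] \<alpha>\<beta>_linear algebra_simps sum.distrib)
  moreover have "tensor2 P Q R (r *\<^sub>R X) = r *\<^sub>R tensor2 P Q R X" if "X \<in> T" for X r
    using that by (simp add: tensor2_def tensor_scale[symmetric] \<alpha>\<beta>_linear algebra_simps sum_distrib_left)
  moreover have "tensor2 P Q R X \<in> hom_on T semibasic" for X
    using tensor_hom subspace_0[OF subspace_hom_on[OF subspace_semibasic]]
    by (cases "X \<in> T") (simp_all only: tensor2_def if_True if_False)
  moreover have "tensor2 P Q R X = 0" if "X \<notin> T" for X using that by (simp add: tensor2_def)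
  ultimately show ?thesis unfolding hom_on_def[of T "hom_on T semibasic"] by blast
qed

lemma tensor2_frame [simp]:
  assumes "i \<le> m" shows "tensor2 P Q R (H i) = tensor (P i) (Q i)" "tensor2 P Q R (v i) = tensor (Q i) (R i)"
  using assms by (simp_all add: tensor2_def if_distrib[of "\<lambda>r. r * _"] cong: if_cong)

text \<open>
  The first half of the quasi-regular basis.  On \<open>A\<close> with matrices \<open>a\<close> and \<open>w\<close> the row
  \<open>A (regular_vec i)\<close> is \<open>a i + i * w i\<close> for \<open>i < m\<close>, and the distinct factors \<open>i\<close> make the skew part
  of these rows reveal the off-diagonal entries of \<open>w\<close>.  The diagonal of \<open>w\<close> is still free; the column
  sums of \<open>w\<close> in the last row \<open>a m + (\<Sum>k<m. w k)\<close> recover it, by comparison with the last column, which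
  is \<open>a m\<close> alone because the last column of \<open>w\<close> vanishes.
\<close>
definition regular_vec :: "nat \<Rightarrow> 'v" where
  "regular_vec i = H i + (if i < m then real i *\<^sub>R v i else \<Sum>k<m. v k)"

lemma regular_vec_T [simp]: "i \<le> m \<Longrightarrow> regular_vec i \<in> T"
  unfolding regular_vec_def by (cases "i < m") (auto intro!: subspace_add[OF T] subspace_sum[OF T] simp del: T_simps(1))

lemma hom_on_regular_vec:
  assumes A: "A \<in> hom_on T E" and i: "i \<le> m"
  shows "A (regular_vec i) = A (H i) + (if i < m then real i *\<^sub>R A (v i) else \<Sum>k<m. A (v k))"
proof -
  have s: "A (\<Sum>k<m. 1 *\<^sub>R v k) = (\<Sum>k<m. 1 *\<^sub>R A (v k))" by (intro hom_on_sum[OF T A]) simp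
  have "(\<Sum>k<m. v k) \<in> T" by (intro subspace_sum[OF T]) simp
  then show ?thesis using A i s unfolding hom_on_def regular_vec_def by simp
qed

definition regular_components :: "('v \<Rightarrow> 'v \<Rightarrow> real) \<Rightarrow> nat \<times> nat \<Rightarrow> real" where
  "regular_components A = (\<lambda>(i, j). if i \<le> m \<and> j \<le> m then A (regular_vec i) (H j) else 0)"

lemma linear_regular_components: "linear regular_components"
  by (rule linearI) (auto simp: regular_components_def fun_eq_iff scaleR_fun_def)

lemma regular_components_inj:
  assumes A: "A \<in> G1" and ev: "regular_components A = 0" shows "A = 0"
proof -
  have hom: "A \<in> hom_on T semibasic"
    and a_sym: "A (H i) (H j) = A (H j) (H i)" and w_sym: "A (v i) (H j) = A (v j) (H i)"
    and w_m: "A (v m) (H j) = 0" if "i \<le> m" "j \<le> m" for i j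
    using A that unfolding G1_iff by auto
  have hom: "A \<in> hom_on T semibasic" using hom by blast
  have b: "A (H i) (H j) + (if i < m then real i * A (v i) (H j) else \<Sum>k<m. A (v k) (H j)) = 0"
    if "i \<le> m" "j \<le> m" for i j
    using fun_cong[OF ev, of "(i, j)"] that
    by (simp add: regular_components_def hom_on_regular_vec[OF hom] scaleR_fun_def sum_fun_apply split: if_splits)
  have w_jm: "A (v j) (H m) = 0" if "j \<le> m" for j using w_sym[of j m] w_m[of j j] that by simp
  \<comment> \<open>Subtracting the equations for \<open>(i, j)\<close> and \<open>(j, i)\<close> eliminates the symmetric matrix \<open>a\<close>.\<close>
  have w_off: "A (v i) (H j) = 0" if "i < m" "j < m" "i \<noteq> j" for i j
  proof -
    have "(real i - real j) * A (v i) (H j)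
        = (A (H i) (H j) + real i * A (v i) (H j)) - (A (H j) (H i) + real j * A (v j) (H i))"
      using a_sym[of i j] w_sym[of i j] that by (simp add: left_diff_distrib)
    also have "\<dots> = 0" using b[of i j] b[of j i] that by simp
    finally have "(real i - real j) * A (v i) (H j) = 0" .
    then show ?thesis using that by simp
  qed
  \<comment> \<open>Now the column sum of \<open>w\<close> in the last row consists of the diagonal entry only.\<close>
  have w_diag: "A (v j) (H j) = 0" if "j < m" for j
  proof -
    have "(\<Sum>k<m. A (v k) (H j)) = (\<Sum>k<m. if k = j then A (v j) (H j) else 0)"
      using w_off that by (intro sum.cong) auto
    moreover have "A (H m) (H j) = 0"
      using b[of j m] a_sym[of j m] w_jm[of j] that by simp
    ultimately show ?thesis using b[of m j] that by simp
  qed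
  have w: "A (v i) (H j) = 0" if "i \<le> m" "j \<le> m" for i j
  proof (cases "i = m \<or> j = m")
    case True then show ?thesis using w_jm w_m that by blast
  next
    case False then show ?thesis using w_off w_diag that by (metis le_neq_implies_less)
  qed
  have a: "A (H i) (H j) = 0" if "i \<le> m" "j \<le> m" for i j
  proof -
    have "(\<Sum>k<m. A (v k) (H j)) = 0" using w that by (intro sum.neutral) auto
    then show ?thesis using b[OF that] w that by (simp split: if_splits)
  qed
  have sb: "A X \<in> semibasic" if "X \<in> T" for X using hom that unfolding hom_on_def by blast
  note z = subspace_0[OF subspace_semibasic]
  show ?thesis
  proof (rule hom_on_eqI[OF hom subspace_0[OF subspace_hom_on[OF subspace_semibasic]]])
    fix i assume i: "i \<le> m"
    show "A (H i) = 0 (H i)" using semibasic_eqI[OF sb z, of "H i"] i a by simp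
    show "A (v i) = 0 (v i)" using semibasic_eqI[OF sb z, of "v i"] i w by simp
  qed
qed

text \<open>
  Solving the same linear equations, with an arbitrary right-hand side \<open>b\<close>.
\<close>
lemma regular_components_surj:
  obtains A where "A \<in> G1" "\<And>i j. i \<le> m \<Longrightarrow> j \<le> m \<Longrightarrow> A (regular_vec i) (H j) = b i j"
proof -
  \<comment> \<open>The skew part of the system is \<open>b i j - b j i = (i - j) * w i j\<close> for \<open>i, j < m\<close>.\<close>
  define off where "off i j = (b i j - b j i) / (real i - real j)" for i j
  define w where "w i j = (if i = m \<or> j = m then 0
      else if i = j then b m j - b j m - (\<Sum>k\<in>{..<m} - {j}. off k j) else off i j)" for i j
  \<comment> \<open>In the last row and column, \<open>a\<close> is read off from the last column of \<open>b\<close>.\<close>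
  define a where "a i j = (if i < m \<and> j < m then b i j - real i * w i j else b (min i j) (max i j))" for i j
  have off_sym: "off i j = off j i" for i j
    by (simp add: off_def divide_simps) (auto simp: algebra_simps)
  have off_eq: "(real i - real j) * off i j = b i j - b j i" if "i \<noteq> j" for i j
    using that by (simp add: off_def)
  have a_sym: "a i j = a j i" if "i \<le> m" "j \<le> m" for i j
  proof (cases "i < m \<and> j < m \<and> i \<noteq> j")
    case True
    then show ?thesis using off_eq[of i j] off_sym[of i j] by (simp add: a_def w_def algebra_simps)
  qed (auto simp: a_def min.commute max.commute)
  have w_sym: "w i j = w j i" for i j using off_sym[of i j] by (auto simp: w_def)
  have w_sum: "(\<Sum>k<m. w k j) = b m j - b j m" if "j < m" for j
  proof -
    have "(\<Sum>k<m. w k j) = w j j + (\<Sum>k\<in>{..<m} - {j}. w k j)"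
      using that by (intro sum.remove) auto
    also have "(\<Sum>k\<in>{..<m} - {j}. w k j) = (\<Sum>k\<in>{..<m} - {j}. off k j)"
      using that by (intro sum.cong) (auto simp: w_def)
    finally show ?thesis using that by (simp add: w_def)
  qed
  have wm: "w m j = 0" "w j m = 0" for j by (simp_all add: w_def)
  show thesis
  proof
    show "tensor a w \<in> G1" using a_sym w_sym wm by (auto simp: G1_iff tensor_hom)
    fix i j assume ij: "i \<le> m" "j \<le> m"
    then have "tensor a w (regular_vec i) (H j) = a i j + (if i < m then real i * w i j else \<Sum>k<m. w k j)"
      by (simp add: hom_on_regular_vec[OF tensor_hom] scaleR_fun_def sum_fun_apply)
    also have "\<dots> = b i j"
    proof (cases "j = m")
      case True then show ?thesis using ij by (auto simp: wm a_def)
    next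
      case False
      then show ?thesis using ij w_sum[of j] by (cases "i = m") (auto simp: a_def)
    qed
    finally show "tensor a w (regular_vec i) (H j) = b i j" .
  qed
qed

definition regular_basis :: "'v list" where
  "regular_basis = map regular_vec [0..<Suc m] @ map v [0..<Suc m]"

text \<open>
  The rows \<open>A (regular_vec i)\<close> of an element of \<open>G1\<close> are arbitrary and determine it.  Annihilating the
  first \<open>j\<close> basis vectors therefore means that the first \<open>j\<close> rows vanish.  For \<open>j > m\<close> no row is left,
  in agreement with the truncated difference.
\<close>
lemma dim_G1_vanishing:
  "dim {A \<in> G1. \<forall>x\<in>set (take j regular_basis). A x = 0} = (Suc m - j) * Suc m" (is "dim ?S = _")
proof -
  have inj: "inj_on regular_components G1"
    using linear_injective_on_subspace_0[OF linear_regular_components subspace_G1] regular_components_inj by blast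
  have sub: "subspace ?S"
    using subspace_G1 unfolding subspace_def by (auto simp: scaleR_fun_def)
  have e_in: "regular_vec i \<in> set (take j regular_basis)" if "i < j" "i \<le> m" for i
  proof -
    have "take j regular_basis ! i = regular_vec i" "i < length (take j regular_basis)"
      using that by (simp_all add: regular_basis_def nth_append del: upt_Suc)
    then show ?thesis by (metis nth_mem)
  qed
  have take_e: "set (take j regular_basis) \<subseteq> regular_vec ` {..<j}" if "j \<le> m"
    using that by (auto simp: regular_basis_def take_map simp del: upt_Suc)
  have "regular_components ` ?S = supported_on ({j..m} \<times> {..m})"
  proof
    show "regular_components ` ?S \<subseteq> supported_on ({j..m} \<times> {..m})"
    proof clarsimp
      fix A assume "A \<in> G1" and z: "\<forall>x\<in>set (take j regular_basis). A x = 0"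
      have "A (regular_vec i) (H k) = 0" if "i < j" "i \<le> m" for i k using z e_in[OF that] by simp
      then show "regular_components A \<in> supported_on ({j..m} \<times> {..m})"
        by (auto simp: supported_on_def regular_components_def)
    qed
    show "supported_on ({j..m} \<times> {..m}) \<subseteq> regular_components ` ?S"
    proof
      fix g :: "nat \<times> nat \<Rightarrow> real" assume g: "g \<in> supported_on ({j..m} \<times> {..m})"
      obtain A where A: "A \<in> G1" and Ab: "\<And>i k. i \<le> m \<Longrightarrow> k \<le> m \<Longrightarrow> A (regular_vec i) (H k) = g (i, k)"
        using regular_components_surj[of "\<lambda>i k. g (i, k)"] by blast
      have "regular_components A = g" using g by (auto simp: regular_components_def supported_on_def Ab fun_eq_iff)
      moreover have "A \<in> ?S"
      proof (cases "j \<le> m")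
        case True
        have "A (regular_vec i) = 0" if "i < j" for i
        proof (rule semibasic_eqI)
          show "A (regular_vec i) \<in> semibasic" using A that True by (simp add: G1_iff hom_on_def)
          show "A (regular_vec i) (H k) = 0 (H k)" if "k \<le> m" for k
            using Ab[of i k] that \<open>i < j\<close> True g by (simp add: supported_on_def)
        qed (rule subspace_0[OF subspace_semibasic])
        then show ?thesis using A take_e[OF True] by blast
      next
        case False
        \<comment> \<open>Here the list also contains vertical vectors, but already \<open>A = 0\<close>.\<close>
        then have "g = 0" using g by (auto simp: supported_on_def fun_eq_iff)
        then have "A = 0" using regular_components_inj[OF A] \<open>regular_components A = g\<close> by simp
        then show ?thesis using A by simp
      qed
      ultimately show "g \<in> regular_components ` ?S" by blast
    qed
  qed
  then have "dim ?S = card ({j..m} \<times> {..m})"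
    using dim_linear_image[OF linear_regular_components sub inj_on_subset[OF inj]] dim_supported_on[of "{j..m} \<times> {..m}"]
    by auto
  then show ?thesis by (simp add: card_cartesian_product)
qed

end

definition sorted_triples :: "nat \<Rightarrow> (nat \<times> nat \<times> nat) set" where
  "sorted_triples N = {(i, j, k). i \<le> j \<and> j \<le> k \<and> k < N}"

lemma sorted_triples_finite: "finite (sorted_triples N)"
  by (rule finite_subset[of _ "{..<N} \<times> {..<N} \<times> {..<N}"]) (auto simp: sorted_triples_def)

lemma card_sorted_triples: "6 * card (sorted_triples N) = N * (N + 1) * (N + 2)"
proof (induction N)
  case (Suc N)
  define F where "F = (SIGMA j : {..N}. {..j})"
  have split: "sorted_triples (Suc N) = sorted_triples N \<union> (\<lambda>(j, i). (i, j, N)) ` F"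
    by (auto simp: sorted_triples_def F_def image_iff less_Suc_eq)
  have "card (sorted_triples (Suc N)) = card (sorted_triples N) + card ((\<lambda>(j, i). (i, j, N)) ` F)"
    unfolding split by (intro card_Un_disjoint sorted_triples_finite)
      (auto simp: sorted_triples_def F_def)
  also have "card ((\<lambda>(j, i). (i, j, N)) ` F) = card F"
    by (intro card_image inj_onI) auto
  also have "card F = (\<Sum>j\<le>N. Suc j)" by (simp add: F_def)
  finally have "card (sorted_triples (Suc N)) = card (sorted_triples N) + (\<Sum>j\<le>N. Suc j)" .
  moreover have "2 * (\<Sum>j\<le>N. Suc j) = (N + 1) * (N + 2)" by (induction N) auto
  ultimately show ?case using Suc by (simp add: algebra_simps)
next
  case 0
  have "sorted_triples 0 = {}" by (auto simp: sorted_triples_def)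
  then show ?case by simp
qed

definition sort3 :: "nat \<Rightarrow> nat \<Rightarrow> nat \<Rightarrow> nat \<times> nat \<times> nat" where
  "sort3 i j k = (min i (min j k), max (min i j) (min (max i j) k), max i (max j k))"

lemma sort3_sym: "sort3 i j k = sort3 j i k" "sort3 i j k = sort3 i k j"
  by (auto simp: sort3_def min_def max_def)

lemma sort3_sorted: "i \<le> j \<Longrightarrow> j \<le> k \<Longrightarrow> sort3 i j k = (i, j, k)"
  by (auto simp: sort3_def min_def max_def)

lemma symmetric_zeroI:
  fixes f :: "nat \<Rightarrow> nat \<Rightarrow> nat \<Rightarrow> real"
  assumes sym: "\<And>i j k. i < N \<Longrightarrow> j < N \<Longrightarrow> k < N \<Longrightarrow> f i j k = f j i k"
      "\<And>i j k. i < N \<Longrightarrow> j < N \<Longrightarrow> k < N \<Longrightarrow> f i j k = f i k j"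
    and zero: "\<And>i j k. (i, j, k) \<in> sorted_triples N \<Longrightarrow> f i j k = 0"
    and "i < N" "j < N" "k < N"
  shows "f i j k = 0"
proof -
  have z: "f i j k = 0" if "i \<le> j" "j \<le> k" "k < N" for i j k
    using zero that by (simp add: sorted_triples_def)
  have perm: "f i k j = f i j k" "f j i k = f i j k" "f j k i = f i j k" "f k i j = f i j k" "f k j i = f i j k"
    using sym(1)[of i j k] sym(2)[of i j k] sym(2)[of j i k] sym(1)[of i k j] sym(1)[of j k i] assms(4-6)
    by simp_all
  consider "i \<le> j" "j \<le> k" | "i \<le> k" "k \<le> j" | "j \<le> i" "i \<le> k" | "j \<le> k" "k \<le> i"
    | "k \<le> i" "i \<le> j" | "k \<le> j" "j \<le> i" by linarith
  then show ?thesis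
    using z[of i j k] z[of i k j] z[of j i k] z[of j k i] z[of k i j] z[of k j i] assms(4-6)
    unfolding perm by cases blast+
qed

context adapted_frame
begin

text \<open>
  The first entry counts the vertical arguments.  With at least one of them the index \<open>m\<close> is excluded,
  because by symmetry the Liouville vector may then be moved to a vertical slot.
\<close>
definition frame_indices :: "(nat \<times> nat \<times> nat \<times> nat) set" where
  "frame_indices = {0} \<times> sorted_triples (Suc m) \<union> {1, 2} \<times> sorted_triples m"

definition frame_components :: "('v \<Rightarrow> 'v \<Rightarrow> 'v \<Rightarrow> real) \<Rightarrow> nat \<times> nat \<times> nat \<times> nat \<Rightarrow> real" where
  "frame_components B = (\<lambda>(t, i, j, k). if (t, i, j, k) \<in> frame_indices
     then B (if t = 0 then H i else v i) (if t = 2 then v j else H j) (H k) else 0)"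

lemma linear_frame_components: "linear frame_components"
  by (rule linearI) (auto simp: frame_components_def fun_eq_iff scaleR_fun_def)

text \<open>
  The symmetry of \<open>B\<close> in its first two arguments and the symmetry of the matrices of each \<open>B X\<close>
  combine to total symmetry of the three component arrays.  For one vertical argument the exchange of
  \<open>i\<close> and \<open>j\<close> in \<open>B (v i) (H j) (H k)\<close> takes five such steps.
\<close>
lemma frame_components_inj:
  assumes B: "B \<in> G2" and ev: "frame_components B = 0" shows "B = 0"
proof -
  have hom: "B \<in> hom_on T (hom_on T semibasic)" using B by (simp add: G2_def)
  have sym: "B X Y Z = B Y X Z" if "X \<in> T" "Y \<in> T" for X Y Z
    using B that by (simp add: G2_def)
  have G: "B X \<in> G1" if "X \<in> T" for X using B that by (simp add: G2_def)
  have s1: "B X (H j) (H k) = B X (H k) (H j)" and s2: "B X (v j) (H k) = B X (v k) (H j)"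
    and s3: "B X (v m) (H k) = 0" if "X \<in> T" "j \<le> m" "k \<le> m" for X j k
    using G[OF that(1)] that(2,3) unfolding G1_iff by auto
  have P: "B (H i) (H j) (H k) = 0" if "i \<le> m" "j \<le> m" "k \<le> m" for i j k
  proof (rule symmetric_zeroI[of "Suc m" "\<lambda>i j k. B (H i) (H j) (H k)"])
    show "B (H i) (H j) (H k) = 0" if "(i, j, k) \<in> sorted_triples (Suc m)" for i j k
      using fun_cong[OF ev, of "(0, i, j, k)"] that by (simp add: frame_components_def frame_indices_def)
  qed (use that sym s1 in auto)
  have Q': "B (v i) (H j) (H k) = B (v j) (H i) (H k)" if "i \<le> m" "j \<le> m" "k \<le> m" for i j k
  proof -
    have "B (v i) (H j) (H k) = B (v i) (H k) (H j)" using that by (intro s1) auto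
    also have "\<dots> = B (H k) (v i) (H j)" using that by (intro sym) auto
    also have "\<dots> = B (H k) (v j) (H i)" using that by (intro s2) auto
    also have "\<dots> = B (v j) (H k) (H i)" using that by (intro sym) auto
    also have "\<dots> = B (v j) (H i) (H k)" using that by (intro s1) auto
    finally show ?thesis .
  qed
  have Q: "B (v i) (H j) (H k) = 0" if "i \<le> m" "j \<le> m" "k \<le> m" for i j k
  proof (cases "i < m \<and> j < m \<and> k < m")
    case True
    show ?thesis
    proof (rule symmetric_zeroI[of m "\<lambda>i j k. B (v i) (H j) (H k)"])
      show "B (v i) (H j) (H k) = 0" if "(i, j, k) \<in> sorted_triples m" for i j k
        using fun_cong[OF ev, of "(1, i, j, k)"] that by (simp add: frame_components_def frame_indices_def)
    qed (use True s1 Q' in auto)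
  next
    case False
    have "B (v m) (H j) (H k) = 0" if "j \<le> m" "k \<le> m" for j k
      using s3[of "H j" k k] sym[of "v m" "H j"] that by simp
    then show ?thesis
      using False that Q'[of i j k] Q'[of i k j] s1[of "v i" j k] by (auto simp: not_less dest: le_antisym)
  qed
  have R: "B (v i) (v j) (H k) = 0" if "i \<le> m" "j \<le> m" "k \<le> m" for i j k
  proof (cases "i < m \<and> j < m \<and> k < m")
    case True
    show ?thesis
    proof (rule symmetric_zeroI[of m "\<lambda>i j k. B (v i) (v j) (H k)"])
      show "B (v i) (v j) (H k) = 0" if "(i, j, k) \<in> sorted_triples m" for i j k
        using fun_cong[OF ev, of "(2, i, j, k)"] that by (simp add: frame_components_def frame_indices_def)
    qed (use True sym s2 in auto)
  next
    case False
    have "B (v i) (v m) (H k) = 0" if "i \<le> m" "k \<le> m" for i k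
      using s3[of "v i" k k] that by simp
    then show ?thesis
      using False that s2[of "v i" j k] sym[of "v i" "v j" "H k"] by (auto simp: not_less dest: le_antisym)
  qed
  have z: "0 \<in> hom_on T semibasic" "0 \<in> hom_on T (hom_on T semibasic)"
    by (intro subspace_0 subspace_hom_on subspace_semibasic)+
  have eq0: "A = 0" if A: "A \<in> hom_on T semibasic"
    and "\<And>j k. j \<le> m \<Longrightarrow> k \<le> m \<Longrightarrow> A (H j) (H k) = 0" "\<And>j k. j \<le> m \<Longrightarrow> k \<le> m \<Longrightarrow> A (v j) (H k) = 0"
  for A
  proof (rule hom_on_eqI[OF A z(1)])
    have sb: "A X \<in> semibasic" if "X \<in> T" for X using A that unfolding hom_on_def by blast
    fix j assume j: "j \<le> m"
    show "A (H j) = 0 (H j)" "A (v j) = 0 (v j)"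
      using that j semibasic_eqI[OF sb subspace_0[OF subspace_semibasic]] by simp_all
  qed
  have Bv: "B (H i) (v j) (H k) = 0" if "i \<le> m" "j \<le> m" "k \<le> m" for i j k
    using sym[of "H i" "v j"] Q that by simp
  show ?thesis
  proof (rule hom_on_eqI[OF hom z(2)])
    fix i assume i: "i \<le> m"
    then have "B (H i) \<in> hom_on T semibasic" "B (v i) \<in> hom_on T semibasic"
      using hom unfolding hom_on_def[of T "hom_on T semibasic"] by auto
    then show "B (H i) = 0 (H i)" "B (v i) = 0 (v i)"
      using eq0 P Q R Bv i by simp_all
  qed
qed

lemma tensor2_G2:
  assumes P: "\<And>i j k. P i j k = P j i k" "\<And>i j k. P i j k = P i k j"
    and Q: "\<And>i j k. Q i j k = Q j i k" "\<And>i j k. Q i j k = Q i k j"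
    and R: "\<And>i j k. R i j k = R j i k" "\<And>i j k. R i j k = R i k j"
    and m: "\<And>j k. Q m j k = 0" "\<And>j k. R m j k = 0"
  shows "tensor2 P Q R \<in> G2"
  unfolding G2_def
proof (intro CollectI conjI ballI)
  show "tensor2 P Q R \<in> hom_on T (hom_on T semibasic)" by (rule tensor2_hom)
  fix X assume X: "X \<in> T"
  have "tensor a w \<in> G1" if "\<And>i j. a i j = a j i" "\<And>i j. w i j = w j i" "\<And>j. w m j = 0" for a w
    using that by (auto simp: G1_iff tensor_hom)
  moreover have "Q i m k = 0" "R i m k = 0" for i k
    using m Q(1)[of i m k] R(1)[of i m k] by simp_all
  ultimately show "tensor2 P Q R X \<in> G1" using X P(2) Q(2) R(2)
    unfolding tensor2_def by (simp only: if_True) (auto intro!: sum.cong)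
  fix Y assume Y: "Y \<in> T"
  define F where "F X Y k i j = \<alpha> j Y * (\<alpha> i X * P i j k + \<beta> i X * Q i j k)
      + \<beta> j Y * (\<alpha> i X * Q i j k + \<beta> i X * R i j k)" for X Y k i j
  have e: "tensor2 P Q R X Y = form (\<lambda>k. \<Sum>j\<le>m. \<Sum>i\<le>m. F X Y k i j)"
    if "X \<in> T" "Y \<in> T" for X Y
    using that by (simp add: tensor2_def tensor_def F_def sum_distrib_left flip: sum.distrib)
  have "(\<Sum>j\<le>m. \<Sum>i\<le>m. F X Y k i j) = (\<Sum>j\<le>m. \<Sum>i\<le>m. F Y X k i j)" for k
  proof -
    have "F X Y k i j = F Y X k j i" for i j
      using P(1)[of i j] Q(1)[of i j] R(1)[of i j] by (simp add: F_def algebra_simps)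
    then show ?thesis by (subst sum.swap) simp
  qed
  then show "tensor2 P Q R X Y = tensor2 P Q R Y X" by (simp add: e X Y)
qed

text \<open>
  The values at sorted index triples can be prescribed freely: sorting the indices extends them to
  totally symmetric arrays.
\<close>
lemma dim_G2: "dim G2 = card (sorted_triples (Suc m)) + 2 * card (sorted_triples m)"
proof -
  have fin: "finite frame_indices" by (simp add: frame_indices_def sorted_triples_finite)
  have "frame_components ` G2 = supported_on frame_indices"
  proof
    show "frame_components ` G2 \<subseteq> supported_on frame_indices" by (auto simp: frame_components_def supported_on_def)
    show "supported_on frame_indices \<subseteq> frame_components ` G2"
    proof
      fix g assume g: "g \<in> supported_on frame_indices"
      define c where "c t i j k = g (t, sort3 i j k)" for t i j k
      have sym: "c t i j k = c t j i k" "c t i j k = c t i k j" for t i j k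
        unfolding c_def using sort3_sym[of i j k] by simp_all
      have "(t, sort3 m j k) \<notin> frame_indices" if "t \<noteq> 0" for t j k
        using that by (auto simp: frame_indices_def sort3_def sorted_triples_def)
      then have "c t m j k = 0" if "t \<noteq> 0" for t j k
        using g that unfolding supported_on_def c_def by blast
      then have mem: "tensor2 (c 0) (c 1) (c 2) \<in> G2"
        by (intro tensor2_G2 sym) auto
      have "frame_components (tensor2 (c 0) (c 1) (c 2)) x = g x" for x
      proof (cases "x \<in> frame_indices")
        case True
        obtain t i j k where x: "x = (t, i, j, k)" by (cases x) auto
        from True x have "t = 0 \<or> t = 1 \<or> t = 2" "i \<le> j" "j \<le> k" "k \<le> m"
          by (auto simp: frame_indices_def sorted_triples_def)
        with True show ?thesis by (auto simp: x frame_components_def c_def sort3_sorted)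
      next
        case False
        then show ?thesis using g by (cases x) (auto simp: frame_components_def supported_on_def)
      qed
      then show "g \<in> frame_components ` G2" using mem by (metis ext imageI)
    qed
  qed
  moreover have "inj_on frame_components G2"
    using linear_injective_on_subspace_0[OF linear_frame_components subspace_G2] frame_components_inj by blast
  ultimately have "dim G2 = card frame_indices"
    using dim_linear_image[OF linear_frame_components subspace_G2] dim_supported_on[OF fin] by metis
  also have "\<dots> = card ({0::nat} \<times> sorted_triples (Suc m)) + card ({1::nat, 2} \<times> sorted_triples m)"
    unfolding frame_indices_def by (intro card_Un_disjoint) (auto simp: sorted_triples_finite)
  finally show ?thesis by (simp add: card_cartesian_product)
qed

text \<open>
  The horizontal coordinates of \<open>regular_vec i\<close> are those of \<open>H i\<close>, so the change from the frame
  \<open>(H, v)\<close> to this basis is unipotent.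
\<close>
lemma is_basis_regular_basis: "is_basis T regular_basis"
proof -
  define w where "w i = (if i \<le> m then regular_vec i else v (i - Suc m))" for i
  have fb: "regular_basis = map w [0..<2 * Suc m]"
    by (rule nth_equalityI) (auto simp: regular_basis_def w_def nth_append simp del: upt_Suc)
  have wT: "w i \<in> T" if "i < 2 * Suc m" for i using that by (auto simp: w_def)
  have lin_e: "\<alpha> k (regular_vec i) = (if k = i then 1 else 0)" if "k \<le> m" "i \<le> m" for k i
    using that by (simp add: regular_vec_def \<alpha>\<beta>_linear linear_sum[OF lin_\<alpha>])
  have zero: "c i = 0" if s: "(\<Sum>i<2 * Suc m. c i *\<^sub>R w i) = 0" and i: "i < 2 * Suc m" for c i
  proof -
    have "{..<2 * Suc m} = {..m} \<union> {Suc m..<2 * Suc m}" by auto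
    then have "(\<Sum>i<2 * Suc m. c i *\<^sub>R w i) = (\<Sum>i\<le>m. c i *\<^sub>R w i) + (\<Sum>i=Suc m..<2 * Suc m. c i *\<^sub>R w i)"
      by (metis (no_types, lifting) finite_atMost finite_atLeastLessThan sum.union_disjoint
          atLeastLessThan_iff atMost_iff disjoint_iff not_less_eq_eq)
    also have "(\<Sum>i=Suc m..<2 * Suc m. c i *\<^sub>R w i) = (\<Sum>i\<le>m. c (i + Suc m) *\<^sub>R w (i + Suc m))"
      using sum.shift_bounds_nat_ivl[of "\<lambda>i. c i *\<^sub>R w i" 0 "Suc m" "Suc m"]
      by (simp add: atLeast0LessThan lessThan_Suc_atMost mult_2)
    finally have z: "(\<Sum>i\<le>m. c i *\<^sub>R regular_vec i) + (\<Sum>i\<le>m. c (i + Suc m) *\<^sub>R v i) = 0"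
      using s by (simp add: w_def)
    have ce: "c k = 0" if "k \<le> m" for k
    proof -
      have "\<alpha> k ((\<Sum>i\<le>m. c i *\<^sub>R regular_vec i) + (\<Sum>i\<le>m. c (i + Suc m) *\<^sub>R v i)) = c k"
        using that by (simp add: \<alpha>\<beta>_linear linear_sum[OF lin_\<alpha>] lin_e if_distrib[of "\<lambda>r. _ * r"] cong: if_cong)
      then show ?thesis using z linear_0[OF lin_\<alpha>] by simp
    qed
    have cv: "c (k + Suc m) = 0" if "k \<le> m" for k
    proof -
      have "\<beta> k (\<Sum>i\<le>m. c (i + Suc m) *\<^sub>R v i) = c (k + Suc m)"
        using that by (simp add: \<alpha>\<beta>_linear linear_sum[OF lin_\<beta>] if_distrib[of "\<lambda>r. _ * r"] cong: if_cong)
      then show ?thesis using z ce linear_0[OF lin_\<beta>] by simp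
    qed
    show ?thesis using ce[of i] cv[of "i - Suc m"] i by (cases "i \<le> m") auto
  qed
  have inj: "inj_on w {..<2 * Suc m}" by (rule independent_family) (auto intro: zero)
  have ind: "independent (w ` {..<2 * Suc m})" by (rule independent_family) (auto intro: zero)
  have set: "set regular_basis = w ` {..<2 * Suc m}" by (simp add: fb atLeast0LessThan del: upt_Suc)
  have v_sp: "v i \<in> span (set regular_basis)" and e_sp: "regular_vec i \<in> span (set regular_basis)" if "i \<le> m" for i
    using that by (auto simp: regular_basis_def simp del: upt_Suc intro!: span_base)
  have H_sp: "H i \<in> span (set regular_basis)" if "i \<le> m" for i
  proof -
    have "H i = regular_vec i - (if i < m then real i *\<^sub>R v i else \<Sum>k<m. v k)" by (simp add: regular_vec_def)
    then show ?thesis using that v_sp e_sp by (auto intro!: span_diff span_scale span_sum)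
  qed
  have "span (set regular_basis) = T"
  proof
    show "span (set regular_basis) \<subseteq> T" using wT T by (intro span_minimal) (auto simp: set)
    show "T \<subseteq> span (set regular_basis)"
    proof
      fix X assume "X \<in> T"
      then have "X = (\<Sum>i\<le>m. \<alpha> i X *\<^sub>R H i) + (\<Sum>i\<le>m. \<beta> i X *\<^sub>R v i)" by (rule expand)
      moreover have "\<dots> \<in> span (set regular_basis)" using H_sp v_sp by (intro span_add span_sum span_scale) auto
      ultimately show "X \<in> span (set regular_basis)" by simp
    qed
  qed
  then show ?thesis
    using inj ind set unfolding is_basis_def fb by (simp add: distinct_map atLeast0LessThan del: upt_Suc)
qed

text \<open>
  With \<open>n = m + 1\<close> both sides equal \<open>n\<^sup>2 (n + 1) / 2\<close>: on the right this is
  \<open>n\<^sup>2 + (\<Sum>j<n. n j)\<close>, on the left \<open>n (n + 1) (n + 2) / 6 + 2 (n - 1) n (n + 1) / 6\<close>.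
\<close>
lemma cartan_equality:
  "dim G2 = dim G1 + (\<Sum>j=1..2 * Suc m. dim {A \<in> G1. \<forall>x\<in>set (take j regular_basis). A x = 0})"
proof -
  have G1: "dim G1 = Suc m * Suc m" using dim_G1_vanishing[of 0] by simp
  have s1: "(\<Sum>j=1..2 * Suc m. (Suc m - j) * Suc m) = (\<Sum>j=1..Suc m. (Suc m - j) * Suc m)"
    by (rule sum.mono_neutral_right) auto
  have s2: "2 * (\<Sum>j=1..n. (n - j) * k) = n * (n - 1) * k" for n k :: nat
  proof (induction n)
    case (Suc n)
    have "(\<Sum>j=1..Suc n. (Suc n - j) * k) = n * k + (\<Sum>j=1..n. (n - j) * k)"
      by (subst sum.atLeast_Suc_atMost) (auto simp: sum.shift_bounds_cl_Suc_ivl simp del: sum.cl_ivl_Suc)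
    then have "2 * (\<Sum>j=1..Suc n. (Suc n - j) * k) = 2 * (n * k) + n * (n - 1) * k"
      using Suc by (simp only: distrib_left)
    then show ?case by (cases n) (auto simp: algebra_simps)
  qed simp
  have "2 * (\<Sum>j=1..2 * Suc m. (Suc m - j) * Suc m) = Suc m * m * Suc m"
    by (simp only: s1 s2 diff_Suc_1)
  moreover have "6 * dim G2 = 3 * (Suc m * Suc m * (m + 2))"
    using card_sorted_triples[of m] card_sorted_triples[of "Suc m"] by (simp add: dim_G2 algebra_simps)
  ultimately show ?thesis unfolding dim_G1_vanishing G1 by (simp add: algebra_simps)
qed

end

section \<open>Vector fields on a smooth atlas\<close>

text \<open>
  The function \<open>topology\<close> is only meaningful on predicates that define a topology; injectivity of
  the charts makes images commute with intersections.
\<close>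
lemma openin_manifold_topology:
  assumes inj: "\<And>c. c \<in> \<A> \<Longrightarrow> inj_on (cmap c) (cdom c)"
  shows "openin (manifold_topology \<A>) W \<longleftrightarrow> W \<subseteq> carrier_of \<A> \<and> (\<forall>c\<in>\<A>. open (cmap c ` (W \<inter> cdom c)))"
proof -
  have "istopology (\<lambda>W. W \<subseteq> carrier_of \<A> \<and> (\<forall>c\<in>\<A>. open (cmap c ` (W \<inter> cdom c))))"
    unfolding istopology_def
  proof (intro conjI allI impI ballI)
    fix S T c
    assume S: "S \<subseteq> carrier_of \<A> \<and> (\<forall>c\<in>\<A>. open (cmap c ` (S \<inter> cdom c)))"
      and T: "T \<subseteq> carrier_of \<A> \<and> (\<forall>c\<in>\<A>. open (cmap c ` (T \<inter> cdom c)))"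
    show "S \<inter> T \<subseteq> carrier_of \<A>" using S by blast
    assume c: "c \<in> \<A>"
    have "cmap c ` (S \<inter> T \<inter> cdom c) = cmap c ` (S \<inter> cdom c) \<inter> cmap c ` (T \<inter> cdom c)"
      using inj_on_image_Int[OF inj[OF c], of "S \<inter> cdom c" "T \<inter> cdom c"] by (simp add: Int_ac)
    then show "open (cmap c ` (S \<inter> T \<inter> cdom c))" using S T c by (simp add: open_Int)
  next
    fix \<K> c
    assume K: "\<forall>K\<in>\<K>. K \<subseteq> carrier_of \<A> \<and> (\<forall>c\<in>\<A>. open (cmap c ` (K \<inter> cdom c)))"
    show "\<Union>\<K> \<subseteq> carrier_of \<A>" using K by blast
    assume "c \<in> \<A>"
    have "cmap c ` (\<Union>\<K> \<inter> cdom c) = (\<Union>K\<in>\<K>. cmap c ` (K \<inter> cdom c))" by blast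
    then show "open (cmap c ` (\<Union>\<K> \<inter> cdom c))" using K \<open>c \<in> \<A>\<close> by auto
  qed
  then show ?thesis by (simp add: manifold_topology_def)
qed

locale smooth_atlas =
  fixes \<A> :: "('p, 'e::euclidean_space) chart set"
  assumes inj: "c \<in> \<A> \<Longrightarrow> inj_on (cmap c) (cdom c)"
    and open_overlap: "c \<in> \<A> \<Longrightarrow> d \<in> \<A> \<Longrightarrow> open (cmap c ` (cdom c \<inter> cdom d))"
    and smooth_transition:
      "c \<in> \<A> \<Longrightarrow> d \<in> \<A> \<Longrightarrow> smooth_on (cmap c ` (cdom c \<inter> cdom d)) (local_rep id c d)"
begin

abbreviation jac :: "('p, 'e) chart \<Rightarrow> ('p, 'e) chart \<Rightarrow> 'p \<Rightarrow> 'e \<Rightarrow> 'e" where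
  "jac c d p \<equiv> frechet_derivative (local_rep id c d) (at (cmap c p))"

lemma transition_apply: "c \<in> \<A> \<Longrightarrow> p \<in> cdom c \<Longrightarrow> local_rep id c d (cmap c p) = cmap d p"
  by (simp add: local_rep_def inv_into_f_f[OF inj])

lemma transition_has_derivative:
  assumes "c \<in> \<A>" "d \<in> \<A>" "p \<in> cdom c" "p \<in> cdom d"
  shows "(local_rep id c d has_derivative jac c d p) (at (cmap c p))"
  by (rule smooth_on_has_derivative[OF smooth_transition[OF assms(1,2)]]) (use assms in blast)

lemma linear_jac:
  "c \<in> \<A> \<Longrightarrow> d \<in> \<A> \<Longrightarrow> p \<in> cdom c \<Longrightarrow> p \<in> cdom d \<Longrightarrow> linear (jac c d p)"
  by (rule has_derivative_linear[OF transition_has_derivative])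

lemma open_cmap_Int:
  assumes "c \<in> \<A>" "V \<subseteq> cdom c" "W \<subseteq> cdom c" "open (cmap c ` V)" "open (cmap c ` W)"
  shows "open (cmap c ` (V \<inter> W))"
  using inj_on_image_Int[OF inj[OF assms(1)] assms(2,3)] assms(4,5) by (simp add: open_Int)

lemma jac_chain:
  assumes "c \<in> \<A>" "d \<in> \<A>" "b \<in> \<A>" "p \<in> cdom c" "p \<in> cdom d" "p \<in> cdom b"
  shows "jac c b p v = jac d b p (jac c d p v)"
proof -
  have "((local_rep id d b \<circ> local_rep id c d) has_derivative jac d b p \<circ> jac c d p) (at (cmap c p))"
    using transition_has_derivative[OF assms(2,3,5,6)]
    by (intro diff_chain_at transition_has_derivative assms) (simp add: transition_apply assms)
  moreover have "open (cmap c ` ((cdom c \<inter> cdom d) \<inter> (cdom c \<inter> cdom b)))"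
    by (rule open_cmap_Int) (use assms open_overlap in auto)
  ultimately have "(local_rep id c b has_derivative jac d b p \<circ> jac c d p) (at (cmap c p))"
    by (rule has_derivative_transform_within_open) (use assms in \<open>auto simp: transition_apply\<close>)
  then show ?thesis by (simp add: frechet_derivative_eqI)
qed

lemma jac_self:
  assumes "c \<in> \<A>" "p \<in> cdom c" shows "jac c c p v = v"
proof -
  have "((\<lambda>x. x) has_derivative (\<lambda>v. v)) (at (cmap c p))" by (rule has_derivative_ident)
  then have "(local_rep id c c has_derivative (\<lambda>v. v)) (at (cmap c p))"
    by (rule has_derivative_transform_within_open[OF _ open_overlap[OF assms(1) assms(1)]])
      (use assms in \<open>auto simp: transition_apply\<close>)
  then show ?thesis by (simp add: frechet_derivative_eqI)
qed

lemma tangent_space_iff: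
  "\<xi> \<in> tangent_space \<A> p \<longleftrightarrow> (\<forall>c. \<not> (c \<in> \<A> \<and> p \<in> cdom c) \<longrightarrow> \<xi> c = 0) \<and>
     (\<forall>c\<in>\<A>. \<forall>d\<in>\<A>. p \<in> cdom c \<and> p \<in> cdom d \<longrightarrow> \<xi> d = jac c d p (\<xi> c))"
  by (simp add: tangent_space_def)

lemma tangent_component:
  "\<xi> \<in> tangent_space \<A> p \<Longrightarrow> c \<in> \<A> \<Longrightarrow> d \<in> \<A> \<Longrightarrow> p \<in> cdom c \<Longrightarrow> p \<in> cdom d \<Longrightarrow> \<xi> d = jac c d p (\<xi> c)"
  unfolding tangent_space_iff by blast

definition tangent_of :: "('p, 'e) chart \<Rightarrow> 'p \<Rightarrow> 'e \<Rightarrow> ('p, 'e) tvec" where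
  "tangent_of c p w = (\<lambda>d. if d \<in> \<A> \<and> p \<in> cdom d then jac c d p w else 0)"

lemma tangent_of_in:
  assumes c: "c \<in> \<A>" "p \<in> cdom c" shows "tangent_of c p w \<in> tangent_space \<A> p"
  unfolding tangent_space_iff
proof (intro conjI allI impI ballI)
  show "tangent_of c p w d = 0" if "\<not> (d \<in> \<A> \<and> p \<in> cdom d)" for d
    using that by (auto simp: tangent_of_def)
  fix d b assume db: "d \<in> \<A>" "b \<in> \<A>" "p \<in> cdom d \<and> p \<in> cdom b"
  then have "tangent_of c p w d = jac c d p w" "tangent_of c p w b = jac c b p w"
    by (simp_all only: tangent_of_def simp_thms if_True)
  then show "tangent_of c p w b = jac d b p (tangent_of c p w d)"
    using jac_chain[of c d b p w] c db by (simp only:)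
qed

lemma tangent_of_component [simp]: "c \<in> \<A> \<Longrightarrow> p \<in> cdom c \<Longrightarrow> tangent_of c p w c = w"
  by (simp add: tangent_of_def jac_self)

lemma tangent_eqI:
  assumes "\<xi> \<in> tangent_space \<A> p" "\<eta> \<in> tangent_space \<A> p" "c \<in> \<A>" "p \<in> cdom c" "\<xi> c = \<eta> c"
  shows "\<xi> = \<eta>"
proof
  fix d show "\<xi> d = \<eta> d"
  proof (cases "d \<in> \<A> \<and> p \<in> cdom d")
    case True then show ?thesis
      using tangent_component[OF assms(1,3), of d] tangent_component[OF assms(2,3), of d] assms(4,5)
      by (simp only:)
  next
    case False then show ?thesis using assms(1,2) unfolding tangent_space_iff by metis
  qed
qed

lemma subspace_tangent_space: "subspace (tangent_space \<A> p)"
  unfolding subspace_def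
proof (intro conjI ballI allI)
  show "0 \<in> tangent_space \<A> p"
    unfolding tangent_space_iff by (auto simp: linear_0[OF linear_jac])
  show "\<xi> + \<eta> \<in> tangent_space \<A> p" if "\<xi> \<in> tangent_space \<A> p" "\<eta> \<in> tangent_space \<A> p" for \<xi> \<eta>
    unfolding tangent_space_iff
  proof (intro conjI ballI allI impI)
    fix c d assume "c \<in> \<A>" "d \<in> \<A>" "p \<in> cdom c \<and> p \<in> cdom d"
    then show "(\<xi> + \<eta>) d = jac c d p ((\<xi> + \<eta>) c)"
      using tangent_component[OF that(1), of c d] tangent_component[OF that(2), of c d]
      by (simp only: plus_fun_apply linear_add[OF linear_jac] simp_thms)
  next
    fix c assume "\<not> (c \<in> \<A> \<and> p \<in> cdom c)"
    then have "\<xi> c = 0" "\<eta> c = 0" using that unfolding tangent_space_iff by blast+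
    then show "(\<xi> + \<eta>) c = 0" by simp
  qed
  show "r *\<^sub>R \<xi> \<in> tangent_space \<A> p" if "\<xi> \<in> tangent_space \<A> p" for r \<xi>
    unfolding tangent_space_iff
  proof (intro conjI ballI allI impI)
    fix c d assume "c \<in> \<A>" "d \<in> \<A>" "p \<in> cdom c \<and> p \<in> cdom d"
    then show "(r *\<^sub>R \<xi>) d = jac c d p ((r *\<^sub>R \<xi>) c)"
      using tangent_component[OF that, of c d]
      by (simp only: scaleR_fun_def linear_scale[OF linear_jac] simp_thms)
  next
    fix c assume "\<not> (c \<in> \<A> \<and> p \<in> cdom c)"
    then have "\<xi> c = 0" using that unfolding tangent_space_iff by blast
    then show "(r *\<^sub>R \<xi>) c = 0" by (simp add: scaleR_fun_def)
  qed
qed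

lemma openin_iff:
  "openin (manifold_topology \<A>) W \<longleftrightarrow> W \<subseteq> carrier_of \<A> \<and> (\<forall>c\<in>\<A>. open (cmap c ` (W \<inter> cdom c)))"
  by (rule openin_manifold_topology[OF inj])

lemma openin_cdom: "c \<in> \<A> \<Longrightarrow> openin (manifold_topology \<A>) (cdom c)"
  using open_overlap by (auto simp: openin_iff carrier_of_def Int_commute)

lemma field_rep_apply: "c \<in> \<A> \<Longrightarrow> p \<in> cdom c \<Longrightarrow> field_rep X c (cmap c p) = X p c"
  by (simp add: field_rep_def inv_into_f_f[OF inj])

lemma smooth_field_has_derivative:
  assumes "smooth_vector_field_on \<A> W X" "p \<in> W" "c \<in> \<A>" "p \<in> cdom c"
  shows "(field_rep X c has_derivative frechet_derivative (field_rep X c) (at (cmap c p))) (at (cmap c p))"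
  by (rule smooth_on_has_derivative[of "cmap c ` (W \<inter> cdom c)"])
    (use assms in \<open>auto simp: smooth_vector_field_on_def\<close>)

text \<open>
  The value of a tensor field is defined through extensions of a vector to a vector field.  One
  extension is constant in the coordinates \<open>c\<close>; in other coordinates it is a Jacobian evaluated along
  the inverse coordinate change.
\<close>
lemma smooth_extension:
  assumes c: "c \<in> \<A>" "p \<in> cdom c" and \<xi>: "\<xi> \<in> tangent_space \<A> p"
  obtains X where "smooth_vector_field_on \<A> (cdom c) X" "X p = \<xi>"
proof
  define X where "X q = tangent_of c q (\<xi> c)" for q
  show "X p = \<xi>"
    unfolding X_def by (rule tangent_eqI[OF tangent_of_in[OF c] \<xi> c]) (simp add: c)
  show "smooth_vector_field_on \<A> (cdom c) X"
    unfolding smooth_vector_field_on_def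
  proof (intro conjI ballI)
    show "X q \<in> tangent_space \<A> q" if "q \<in> cdom c" for q
      unfolding X_def by (rule tangent_of_in[OF c(1) that])
    fix d assume d: "d \<in> \<A>"
    let ?O = "cmap d ` (cdom c \<inter> cdom d)"
    have O: "open ?O" using open_overlap[OF d c(1)] by (simp add: Int_commute)
    have "smooth_on ?O (\<lambda>z. frechet_derivative (local_rep id c d) (at (local_rep id d c z)) (\<xi> c))"
    proof (rule smooth_on_derivative_apply[OF O smooth_transition[OF c(1) d]])
      show "smooth_on ?O (local_rep id d c)" using smooth_transition[OF d c(1)] by (simp add: Int_commute)
      show "local_rep id d c ` ?O \<subseteq> cmap c ` (cdom c \<inter> cdom d)" using d by (auto simp: transition_apply)
    qed (rule smooth_on_const)
    then show "smooth_on ?O (field_rep X d)"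
    proof (rule smooth_on_cong[OF O])
      fix z assume "z \<in> ?O"
      then obtain q where q: "q \<in> cdom c" "q \<in> cdom d" "z = cmap d q" by blast
      show "frechet_derivative (local_rep id c d) (at (local_rep id d c z)) (\<xi> c) = field_rep X d z"
        using q d by (simp add: field_rep_apply transition_apply X_def tangent_of_def)
    qed
  qed (rule openin_cdom[OF c(1)])
qed

text \<open>
  Differentiating the transformation law \<open>X\<^sub>d \<circ> \<phi> = D\<phi> (X\<^sub>c)\<close> of the components of \<open>X\<close> under a
  coordinate change \<open>\<phi>\<close> from \<open>c\<close> to \<open>d\<close>.
\<close>
lemma field_transformation_derivative:
  assumes X: "smooth_vector_field_on \<A> W X" and p: "p \<in> W" "c \<in> \<A>" "d \<in> \<A>" "p \<in> cdom c" "p \<in> cdom d"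
  shows "frechet_derivative (field_rep X d) (at (cmap d p)) (jac c d p a)
    = frechet_derivative (\<lambda>z. frechet_derivative (local_rep id c d) (at z) (X p c)) (at (cmap c p)) a
      + jac c d p (frechet_derivative (field_rep X c) (at (cmap c p)) a)"
proof -
  let ?O = "cmap c ` (cdom c \<inter> cdom d)"
  let ?O' = "cmap c ` ((W \<inter> cdom c) \<inter> (cdom c \<inter> cdom d))"
  have O': "open ?O'"
    by (rule open_cmap_Int[OF p(2)])
      (use X p in \<open>auto simp: smooth_vector_field_on_def openin_iff open_overlap\<close>)
  have x: "cmap c p \<in> ?O" "cmap c p \<in> ?O'" using p by auto
  have "((field_rep X d \<circ> local_rep id c d) has_derivative
      frechet_derivative (field_rep X d) (at (cmap d p)) \<circ> jac c d p) (at (cmap c p))"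
    using smooth_field_has_derivative[OF X p(1,3,5)] transition_has_derivative[OF p(2-5)]
    by (intro diff_chain_at) (simp_all add: transition_apply p)
  then have "((\<lambda>z. frechet_derivative (local_rep id c d) (at z) (field_rep X c z)) has_derivative
      frechet_derivative (field_rep X d) (at (cmap d p)) \<circ> jac c d p) (at (cmap c p))"
  proof (rule has_derivative_transform_within_open[OF _ O' x(2)])
    fix z assume "z \<in> ?O'"
    then obtain q where q: "q \<in> W" "q \<in> cdom c" "q \<in> cdom d" "z = cmap c q" by blast
    have "X q \<in> tangent_space \<A> q" using X q(1) by (simp add: smooth_vector_field_on_def)
    from tangent_component[OF this p(2,3) q(2,3)]
    show "(field_rep X d \<circ> local_rep id c d) z = frechet_derivative (local_rep id c d) (at z) (field_rep X c z)"
      using q p by (simp add: transition_apply field_rep_apply)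
  qed
  from has_derivative_unique[OF this has_derivative_pushforward[OF open_overlap[OF p(2,3)] x(1)
      smooth_transition[OF p(2,3)] smooth_field_has_derivative[OF X p(1,2,4)]]]
  show ?thesis using p by (simp add: fun_eq_iff field_rep_apply)
qed

text \<open>
  The second derivatives of the coordinate change cancel because they are symmetric, so the coordinate
  expression of the bracket transforms like a tangent vector.
\<close>
lemma lie_bracket_tangent:
  assumes X: "smooth_vector_field_on \<A> W X" and Y: "smooth_vector_field_on \<A> W Y" and p: "p \<in> W"
  shows "lie_bracket \<A> X Y p \<in> tangent_space \<A> p"
  unfolding tangent_space_iff
proof (intro conjI allI ballI impI)
  show "lie_bracket \<A> X Y p c = 0" if "\<not> (c \<in> \<A> \<and> p \<in> cdom c)" for c
    using that by (auto simp: lie_bracket_def)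
  fix c d assume cd: "c \<in> \<A>" "d \<in> \<A>" "p \<in> cdom c \<and> p \<in> cdom d"
  then have pc: "p \<in> cdom c" and pd: "p \<in> cdom d" by auto
  have Xp: "X p \<in> tangent_space \<A> p" and Yp: "Y p \<in> tangent_space \<A> p"
    using X Y p by (auto simp: smooth_vector_field_on_def)
  note tr = tangent_component[OF Xp cd(1,2) pc pd] tangent_component[OF Yp cd(1,2) pc pd]
  have sym: "frechet_derivative (\<lambda>z. frechet_derivative (local_rep id c d) (at z) (X p c)) (at (cmap c p)) (Y p c)
      = frechet_derivative (\<lambda>z. frechet_derivative (local_rep id c d) (at z) (Y p c)) (at (cmap c p)) (X p c)"
    by (rule second_derivative_symmetric[OF open_overlap[OF cd(1,2)] _ smooth_transition[OF cd(1,2)]])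
      (use pc pd in blast)
  have "lie_bracket \<A> X Y p d = frechet_derivative (field_rep Y d) (at (cmap d p)) (jac c d p (X p c))
      - frechet_derivative (field_rep X d) (at (cmap d p)) (jac c d p (Y p c))"
    using cd(2) pd by (simp only: lie_bracket_def simp_thms if_True tr)
  also have "\<dots> = jac c d p (frechet_derivative (field_rep Y c) (at (cmap c p)) (X p c))
      - jac c d p (frechet_derivative (field_rep X c) (at (cmap c p)) (Y p c))"
    unfolding field_transformation_derivative[OF X p cd(1,2) pc pd]
      field_transformation_derivative[OF Y p cd(1,2) pc pd] sym by (rule add_diff_cancel_left)
  also have "\<dots> = jac c d p (lie_bracket \<A> X Y p c)"
    using cd(1) pc
    by (simp only: lie_bracket_def simp_thms if_True linear_diff[OF linear_jac[OF cd(1,2) pc pd]])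
  finally show "lie_bracket \<A> X Y p d = jac c d p (lie_bracket \<A> X Y p c)" .
qed

end

section \<open>The slit tangent bundle and the horizontal projector\<close>

text \<open>
  The slit tangent bundle carries a smooth atlas itself.  The separate locale keeps this from being
  applied to the slit tangent bundle again, and so on without end.
\<close>
locale slit_bundle = smooth_atlas \<A> for \<A> :: "('p, 'e::euclidean_space) chart set"
begin

abbreviation ind :: "('p, 'e) chart \<Rightarrow> (('p, 'e) tpoint, 'e \<times> 'e) chart" where
  "ind \<equiv> induced_chart \<A>"

lemma induced_cdom: "w \<in> cdom (ind c) \<longleftrightarrow> w \<in> slit_tangent_bundle \<A> \<and> fst w \<in> cdom c"
  by (cases w) (simp add: induced_chart_def)

lemma induced_cmap: "cmap (ind c) w = (cmap c (fst w), snd w c)"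
  by (cases w) (simp add: induced_chart_def)

lemma induced_in: "c \<in> \<A> \<Longrightarrow> ind c \<in> slit_atlas \<A>"
  by (simp add: slit_atlas_def)

lemma slit_chartE:
  assumes "K \<in> slit_atlas \<A>" obtains c where "c \<in> \<A>" "K = ind c"
  using assms by (auto simp: slit_atlas_def)

lemma slit_tangent: "w \<in> slit_tangent_bundle \<A> \<Longrightarrow> snd w \<in> tangent_space \<A> (fst w)"
  by (auto simp: slit_tangent_bundle_def)

lemma slit_component_nonzero:
  assumes "c \<in> \<A>" "w \<in> cdom (ind c)" shows "snd w c \<noteq> 0"
proof
  assume "snd w c = 0"
  then have "snd w = 0"
    using assms by (intro tangent_eqI[OF slit_tangent subspace_0[OF subspace_tangent_space] assms(1)])
      (auto simp: induced_cdom)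
  then show False using assms(2) by (auto simp: induced_cdom slit_tangent_bundle_def)
qed

text \<open>
  The zero section is what is missing from the fibres, and every other vector of components is
  attained.
\<close>
lemma induced_image:
  assumes "c \<in> \<A>" "d \<in> \<A>"
  shows "cmap (ind c) ` (cdom (ind c) \<inter> cdom (ind d)) = cmap c ` (cdom c \<inter> cdom d) \<times> (UNIV - {0})"
proof
  show "cmap (ind c) ` (cdom (ind c) \<inter> cdom (ind d)) \<subseteq> cmap c ` (cdom c \<inter> cdom d) \<times> (UNIV - {0})"
    using slit_component_nonzero[OF assms(1)] by (auto simp: induced_cmap induced_cdom)
  show "cmap c ` (cdom c \<inter> cdom d) \<times> (UNIV - {0}) \<subseteq> cmap (ind c) ` (cdom (ind c) \<inter> cdom (ind d))"
  proof
    fix z assume "z \<in> cmap c ` (cdom c \<inter> cdom d) \<times> (UNIV - {0::'e})"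
    then obtain p v where z: "z = (cmap c p, v)" and p: "p \<in> cdom c" "p \<in> cdom d" and v: "v \<noteq> 0"
      by auto
    have "tangent_of c p v \<noteq> 0"
      using v tangent_of_component[OF assms(1) p(1), of v] by auto
    then have "(p, tangent_of c p v) \<in> slit_tangent_bundle \<A>"
      using p assms tangent_of_in by (auto simp: slit_tangent_bundle_def carrier_of_def)
    then have "(p, tangent_of c p v) \<in> cdom (ind c) \<inter> cdom (ind d)"
      using p by (simp add: induced_cdom)
    moreover have "cmap (ind c) (p, tangent_of c p v) = (cmap c p, v)"
      using p assms by (simp add: induced_cmap)
    ultimately show "z \<in> cmap (ind c) ` (cdom (ind c) \<inter> cdom (ind d))" unfolding z by (metis imageI)
  qed
qed

lemma induced_inj:
  assumes c: "c \<in> \<A>" shows "inj_on (cmap (ind c)) (cdom (ind c))"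
proof (rule inj_onI)
  fix w w' assume w: "w \<in> cdom (ind c)" "w' \<in> cdom (ind c)"
    and eq: "cmap (ind c) w = cmap (ind c) w'"
  have "fst w = fst w'" using eq w inj_onD[OF inj[OF c]] by (simp add: induced_cmap induced_cdom)
  moreover have "snd w = snd w'"
  proof (rule tangent_eqI[OF _ _ c])
    show "snd w \<in> tangent_space \<A> (fst w)" "snd w' \<in> tangent_space \<A> (fst w)" "fst w \<in> cdom c"
      using w slit_tangent[of w] slit_tangent[of w'] \<open>fst w = fst w'\<close> by (auto simp: induced_cdom)
    show "snd w c = snd w' c" using eq by (simp add: induced_cmap)
  qed
  ultimately show "w = w'" by (rule prod_eqI)
qed

text \<open>
  If \<open>\<phi>\<close> is the coordinate change on the base, the induced one is \<open>(x, y) \<mapsto> (\<phi> x, D\<phi>\<^sub>x y)\<close>.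
\<close>
lemma slit_transition:
  assumes "c \<in> \<A>" "d \<in> \<A>" "z \<in> cmap (ind c) ` (cdom (ind c) \<inter> cdom (ind d))"
  shows "local_rep id (ind c) (ind d) z
    = (local_rep id c d (fst z), frechet_derivative (local_rep id c d) (at (fst z)) (snd z))"
proof -
  obtain w where w: "w \<in> cdom (ind c)" "w \<in> cdom (ind d)" "z = cmap (ind c) w" using assms(3) by blast
  then have "local_rep id (ind c) (ind d) z = cmap (ind d) w"
    using induced_inj[OF assms(1)] by (simp add: local_rep_def inv_into_f_f)
  moreover have "snd w d = jac c d (fst w) (snd w c)"
    using w assms by (intro tangent_component slit_tangent) (auto simp: induced_cdom)
  ultimately show ?thesis using w assms by (simp add: induced_cmap induced_cdom transition_apply)
qed

lemma open_induced_image: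
  "c \<in> \<A> \<Longrightarrow> d \<in> \<A> \<Longrightarrow> open (cmap (ind c) ` (cdom (ind c) \<inter> cdom (ind d)))"
  unfolding induced_image by (intro open_Times open_overlap open_delete open_UNIV)

sublocale slit: smooth_atlas "slit_atlas \<A>"
proof
  show "inj_on (cmap K) (cdom K)" if "K \<in> slit_atlas \<A>" for K
    using that induced_inj by (auto elim: slit_chartE)
  show "open (cmap K ` (cdom K \<inter> cdom L))" if "K \<in> slit_atlas \<A>" "L \<in> slit_atlas \<A>" for K L
    using that open_induced_image by (metis slit_chartE)
  show "smooth_on (cmap K ` (cdom K \<inter> cdom L)) (local_rep id K L)"
    if KL: "K \<in> slit_atlas \<A>" "L \<in> slit_atlas \<A>" for K L
  proof -
    obtain c where c: "c \<in> \<A>" "K = ind c" using KL(1) by (rule slit_chartE)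
    obtain d where d: "d \<in> \<A>" "L = ind d" using KL(2) by (rule slit_chartE)
    let ?O = "cmap K ` (cdom K \<inter> cdom L)"
    have O: "open ?O" unfolding c d by (rule open_induced_image[OF c(1) d(1)])
    have sub: "fst ` ?O \<subseteq> cmap c ` (cdom c \<inter> cdom d)"
      unfolding c d induced_image[OF c(1) d(1)] by auto
    note lin = smooth_on_bounded_linear[OF O bounded_linear_fst smooth_on_ident]
      smooth_on_bounded_linear[OF O bounded_linear_snd smooth_on_ident]
    note tr = smooth_transition[OF c(1) d(1)]
    have "smooth_on ?O (\<lambda>z. (local_rep id c d (fst z), frechet_derivative (local_rep id c d) (at (fst z)) (snd z)))"
      by (rule smooth_on_Pair[OF O smooth_on_compose[OF O lin(1) tr sub]
          smooth_on_derivative_apply[OF O tr lin(1) lin(2) sub]])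
    then show ?thesis
      by (rule smooth_on_cong[OF O]) (simp add: c d slit_transition)
  qed
qed

lemma slit_carrier: "carrier_of (slit_atlas \<A>) = slit_tangent_bundle \<A>"
  by (force simp: carrier_of_def slit_atlas_def induced_cdom slit_tangent_bundle_def)

text \<open>
  The Jacobian of an induced coordinate change is block triangular with both diagonal blocks equal to
  \<open>D\<phi>\<close>.  This lemma and the next one are the part of this that concerns the projection and the
  vertical vectors; together they give the invariance of the tangent structure.
\<close>
lemma fst_slit_jac:
  assumes "c \<in> \<A>" "d \<in> \<A>" "u \<in> cdom (ind c)" "u \<in> cdom (ind d)"
  shows "fst (slit.jac (ind c) (ind d) u a) = jac c d (fst u) (fst a)"
proof -
  have "(local_rep id (ind c) (ind d) has_derivative slit.jac (ind c) (ind d) u) (at (cmap (ind c) u))"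
    by (rule slit.transition_has_derivative) (use assms in \<open>auto simp: induced_in\<close>)
  then have "((\<lambda>z. fst (local_rep id (ind c) (ind d) z)) has_derivative
      (\<lambda>a. fst (slit.jac (ind c) (ind d) u a))) (at (cmap (ind c) u))"
    by (rule has_derivative_fst)
  moreover have "((local_rep id c d \<circ> fst) has_derivative jac c d (fst u) \<circ> fst) (at (cmap (ind c) u))"
  proof (rule diff_chain_at)
    show "(fst has_derivative fst) (at (cmap (ind c) u))"
      by (rule bounded_linear_imp_has_derivative[OF bounded_linear_fst])
    show "(local_rep id c d has_derivative jac c d (fst u)) (at (fst (cmap (ind c) u)))"
      using transition_has_derivative[OF assms(1,2)] assms by (simp add: induced_cmap induced_cdom)
  qed
  then have "((\<lambda>z. fst (local_rep id (ind c) (ind d) z)) has_derivative jac c d (fst u) \<circ> fst) (at (cmap (ind c) u))"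
    by (rule has_derivative_transform_within_open[OF _ open_induced_image[OF assms(1,2)]])
      (use assms in \<open>auto simp: slit_transition\<close>)
  ultimately have "(\<lambda>a. fst (slit.jac (ind c) (ind d) u a)) = jac c d (fst u) \<circ> fst"
    by (rule has_derivative_unique)
  from fun_cong[OF this, of a] show ?thesis by simp
qed

lemma slit_jac_vertical:
  assumes "c \<in> \<A>" "d \<in> \<A>" "u \<in> cdom (ind c)" "u \<in> cdom (ind d)"
  shows "slit.jac (ind c) (ind d) u (0, a) = (0, jac c d (fst u) a)"
proof -
  let ?x = "cmap c (fst u)" and ?v = "snd u c"
  have u: "cmap (ind c) u = (?x, ?v)" by (simp add: induced_cmap)
  have p: "fst u \<in> cdom c" "fst u \<in> cdom d" using assms by (auto simp: induced_cdom)
  have der: "(local_rep id (ind c) (ind d) has_derivative slit.jac (ind c) (ind d) u) (at (?x, ?v))"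
    unfolding u[symmetric] by (rule slit.transition_has_derivative) (use assms in \<open>auto simp: induced_in\<close>)
  have "((local_rep id (ind c) (ind d) \<circ> Pair ?x) has_derivative slit.jac (ind c) (ind d) u \<circ> Pair 0) (at ?v)"
  proof (rule diff_chain_at)
    show "(Pair ?x has_derivative Pair 0) (at ?v)"
      by (intro has_derivative_Pair has_derivative_const has_derivative_ident)
  qed (rule der)
  moreover have "((local_rep id (ind c) (ind d) \<circ> Pair ?x) has_derivative (\<lambda>a. (0, jac c d (fst u) a))) (at ?v)"
  proof (rule has_derivative_transform_within_open)
    show "((\<lambda>v. (local_rep id c d ?x, jac c d (fst u) v)) has_derivative (\<lambda>a. (0, jac c d (fst u) a))) (at ?v)"
      using linear_jac[OF assms(1,2) p]
      by (intro has_derivative_Pair has_derivative_const linear_imp_has_derivative)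
    show "open (UNIV - {0::'e})" by (intro open_delete open_UNIV)
    show "?v \<in> UNIV - {0}" using slit_component_nonzero[OF assms(1,3)] by simp
    fix v assume "v \<in> UNIV - {0::'e}"
    then have "(?x, v) \<in> cmap (ind c) ` (cdom (ind c) \<inter> cdom (ind d))"
      unfolding induced_image[OF assms(1,2)] using p by auto
    from slit_transition[OF assms(1,2) this]
    show "(local_rep id c d ?x, jac c d (fst u) v) = (local_rep id (ind c) (ind d) \<circ> Pair ?x) v"
      by simp
  qed
  ultimately have "slit.jac (ind c) (ind d) u \<circ> Pair 0 = (\<lambda>a. (0, jac c d (fst u) a))"
    by (rule has_derivative_unique)
  from fun_cong[OF this, of a] show ?thesis by simp
qed

lemma tangent_structure_in:
  assumes \<xi>: "\<xi> \<in> slit_tangent_space \<A> u"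
  shows "tangent_structure \<xi> \<in> slit_tangent_space \<A> u"
  unfolding slit.tangent_space_iff
proof (intro conjI allI ballI impI)
  fix K assume "\<not> (K \<in> slit_atlas \<A> \<and> u \<in> cdom K)"
  then have "\<xi> K = 0" using \<xi> unfolding slit.tangent_space_iff by blast
  then show "tangent_structure \<xi> K = 0" by (simp add: tangent_structure_def zero_prod_def)
next
  fix K L assume KL: "K \<in> slit_atlas \<A>" "L \<in> slit_atlas \<A>" "u \<in> cdom K \<and> u \<in> cdom L"
  obtain c where c: "c \<in> \<A>" "K = ind c" using KL(1) by (rule slit_chartE)
  obtain d where d: "d \<in> \<A>" "L = ind d" using KL(2) by (rule slit_chartE)
  have u: "u \<in> cdom (ind c)" "u \<in> cdom (ind d)" using KL c d by auto
  have "\<xi> L = slit.jac K L u (\<xi> K)" using slit.tangent_component[OF \<xi> KL(1,2)] KL(3) by blast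
  then have "fst (\<xi> L) = jac c d (fst u) (fst (\<xi> K))"
    using fst_slit_jac[OF c(1) d(1) u] by (simp only: c d)
  then show "tangent_structure \<xi> L = slit.jac K L u (tangent_structure \<xi> K)"
    using slit_jac_vertical[OF c(1) d(1) u] by (simp add: tangent_structure_def c d)
qed

lemma vertical_space_iff:
  assumes c: "c \<in> \<A>" "u \<in> cdom (ind c)"
  shows "\<xi> \<in> vertical_space \<A> u \<longleftrightarrow> \<xi> \<in> slit_tangent_space \<A> u \<and> fst (\<xi> (ind c)) = 0"
proof -
  have proj: "frechet_derivative (local_rep fst (ind d) b) (at (cmap (ind d) u)) a = jac d b (fst u) (fst a)"
    if d: "d \<in> \<A>" "u \<in> cdom (ind d)" and b: "b \<in> \<A>" "fst u \<in> cdom b" for d b a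
  proof -
    have ud: "fst u \<in> cdom d" using d by (simp add: induced_cdom)
    have "((local_rep id d b \<circ> fst) has_derivative jac d b (fst u) \<circ> fst) (at (cmap (ind d) u))"
    proof (rule diff_chain_at)
      show "(fst has_derivative fst) (at (cmap (ind d) u))"
        by (rule bounded_linear_imp_has_derivative[OF bounded_linear_fst])
      show "(local_rep id d b has_derivative jac d b (fst u)) (at (fst (cmap (ind d) u)))"
        using transition_has_derivative[OF d(1) b(1) ud b(2)] by (simp add: induced_cmap)
    qed
    then have "(local_rep fst (ind d) b has_derivative jac d b (fst u) \<circ> fst) (at (cmap (ind d) u))"
    proof (rule has_derivative_transform_within_open[OF _ open_induced_image[OF d(1) d(1)]])
      show "cmap (ind d) u \<in> cmap (ind d) ` (cdom (ind d) \<inter> cdom (ind d))" using d by blast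
      fix z assume "z \<in> cmap (ind d) ` (cdom (ind d) \<inter> cdom (ind d))"
      then obtain w where "w \<in> cdom (ind d)" "z = cmap (ind d) w" by blast
      then show "(local_rep id d b \<circ> fst) z = local_rep fst (ind d) b z"
        using d inv_into_f_f[OF induced_inj[OF d(1)], of w] inv_into_f_f[OF inj[OF d(1)], of "fst w"]
        by (auto simp: local_rep_def induced_cmap induced_cdom)
    qed
    then show ?thesis by (simp add: frechet_derivative_eqI)
  qed
  have pc: "fst u \<in> cdom c" using c by (simp add: induced_cdom)
  show ?thesis
  proof
    assume "\<xi> \<in> vertical_space \<A> u"
    then have "\<xi> \<in> slit_tangent_space \<A> u"
      "frechet_derivative (local_rep fst (ind c) c) (at (cmap (ind c) u)) (\<xi> (ind c)) = 0"
      using induced_in[OF c(1)] c pc by (auto simp: vertical_space_def)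
    then show "\<xi> \<in> slit_tangent_space \<A> u \<and> fst (\<xi> (ind c)) = 0"
      by (simp add: proj[OF c c(1) pc] jac_self[OF c(1) pc])
  next
    assume \<xi>: "\<xi> \<in> slit_tangent_space \<A> u \<and> fst (\<xi> (ind c)) = 0"
    have "frechet_derivative (local_rep fst K b) (at (cmap K u)) (\<xi> K) = 0"
      if K: "K \<in> slit_atlas \<A>" "b \<in> \<A>" "u \<in> cdom K" "fst u \<in> cdom b" for K b
    proof -
      obtain d where d: "d \<in> \<A>" "K = ind d" using K(1) by (rule slit_chartE)
      have ud: "u \<in> cdom (ind d)" "fst u \<in> cdom d" using K(3) d by (auto simp: induced_cdom)
      have "\<xi> (ind d) = slit.jac (ind c) (ind d) u (\<xi> (ind c))"
        using \<xi> c d(1) ud by (intro slit.tangent_component) (auto simp: induced_in)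
      then have "fst (\<xi> (ind d)) = jac c d (fst u) (fst (\<xi> (ind c)))"
        using fst_slit_jac[OF c(1) d(1) c(2) ud(1)] by (simp only:)
      then have "fst (\<xi> (ind d)) = 0"
        using \<xi> linear_0[OF linear_jac[OF c(1) d(1) pc ud(2)]] by simp
      then show ?thesis
        using linear_0[OF linear_jac[OF d(1) K(2) ud(2) K(4)]]
        by (simp add: d(2) proj[OF d(1) ud(1) K(2,4)])
    qed
    then show "\<xi> \<in> vertical_space \<A> u" using \<xi> by (auto simp: vertical_space_def)
  qed
qed

end

locale spray_bundle = slit_bundle +
  fixes S assumes spray: "spray \<A> S"
begin

lemma S_smooth: "smooth_vector_field_on (slit_atlas \<A>) (slit_tangent_bundle \<A>) S"
  using spray by (simp add: spray_def)

text \<open>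
  The condition \<open>J S = C\<close>: the first half of the components of \<open>S\<close> is the fibre coordinate.
\<close>
lemma fst_S:
  assumes "c \<in> \<A>" "u \<in> cdom (ind c)" shows "fst (S u (ind c)) = snd u c"
proof -
  have "tangent_structure (S u) (ind c) = liouville \<A> u (ind c)"
    using spray assms by (simp add: spray_def induced_cdom)
  then show ?thesis using assms by (simp add: tangent_structure_def liouville_def induced_in induced_cmap)
qed

text \<open>
  In coordinates \<open>S = (y, s(x, y))\<close>, and this is the map \<open>N = (\<partial>s/\<partial>y) / 2\<close>, the negative of the usual
  connection coefficients.
\<close>
definition connection :: "('a, 'b) chart \<Rightarrow> ('a, 'b) tpoint \<Rightarrow> 'b \<Rightarrow> 'b" where
  "connection c u a = (1/2) *\<^sub>R snd (frechet_derivative (field_rep S (ind c)) (at (cmap (ind c) u)) (0, a))"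

lemma S_has_derivative:
  assumes "c \<in> \<A>" "u \<in> cdom (ind c)"
  shows "(field_rep S (ind c) has_derivative
    frechet_derivative (field_rep S (ind c)) (at (cmap (ind c) u))) (at (cmap (ind c) u))"
  by (rule slit.smooth_field_has_derivative[OF S_smooth])
    (use assms in \<open>auto simp: induced_in induced_cdom\<close>)

lemma linear_connection:
  assumes "c \<in> \<A>" "u \<in> cdom (ind c)" shows "linear (connection c u)"
proof -
  note lin = has_derivative_linear[OF S_has_derivative[OF assms]]
  have "connection c u (a + b) = connection c u a + connection c u b" for a b
    using linear_add[OF lin, of "(0, a)" "(0, b)"] by (simp add: connection_def scaleR_add_right)
  moreover have "connection c u (r *\<^sub>R a) = r *\<^sub>R connection c u a" for r a
    using linear_scale[OF lin, of r "(0, a)"] by (simp add: connection_def)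
  ultimately show ?thesis by (rule linearI)
qed

lemma fst_S_derivative:
  assumes "c \<in> \<A>" "u \<in> cdom (ind c)"
  shows "fst (frechet_derivative (field_rep S (ind c)) (at (cmap (ind c) u)) a) = snd a"
proof -
  have "((\<lambda>z. fst (field_rep S (ind c) z)) has_derivative
      (\<lambda>a. fst (frechet_derivative (field_rep S (ind c)) (at (cmap (ind c) u)) a))) (at (cmap (ind c) u))"
    by (rule has_derivative_fst[OF S_has_derivative[OF assms]])
  moreover have "((\<lambda>z. fst (field_rep S (ind c) z)) has_derivative snd) (at (cmap (ind c) u))"
  proof (rule has_derivative_transform_within_open[OF _ open_induced_image[OF assms(1) assms(1)]])
    show "(snd has_derivative snd) (at (cmap (ind c) u))"
      by (rule bounded_linear_imp_has_derivative[OF bounded_linear_snd])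
    show "cmap (ind c) u \<in> cmap (ind c) ` (cdom (ind c) \<inter> cdom (ind c))" using assms by blast
    fix z assume "z \<in> cmap (ind c) ` (cdom (ind c) \<inter> cdom (ind c))"
    then obtain w where w: "w \<in> cdom (ind c)" "z = cmap (ind c) w" by blast
    show "snd z = fst (field_rep S (ind c) z)"
      unfolding w(2) slit.field_rep_apply[OF induced_in[OF assms(1)] w(1)] fst_S[OF assms(1) w(1)]
      by (simp add: induced_cmap)
  qed
  ultimately have "(\<lambda>a. fst (frechet_derivative (field_rep S (ind c)) (at (cmap (ind c) u)) a)) = snd"
    by (rule has_derivative_unique)
  then show ?thesis by (rule fun_cong)
qed

definition horizontal_value ::
  "(('a, 'b) tpoint \<Rightarrow> ('a, 'b) ttvec) \<Rightarrow> ('a, 'b) tpoint \<Rightarrow> ('a, 'b) ttvec" where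
  "horizontal_value X u = (1/2) *\<^sub>R (X u - lie_derivative_J \<A> S X u)"

text \<open>
  The terms with derivatives of \<open>X\<close> cancel between \<open>[S, JX]\<close> and \<open>J[S, X]\<close>, which leaves
  \<open>(a, b) \<mapsto> (a, N a)\<close> with \<open>N\<close> the map \<open>connection\<close>.  In particular the value depends on \<open>X u\<close> only.
\<close>
lemma horizontal_value_component:
  assumes X: "smooth_vector_field_on (slit_atlas \<A>) W X" "u \<in> W" and c: "c \<in> \<A>" "u \<in> cdom (ind c)"
  shows "horizontal_value X u (ind c) = (fst (X u (ind c)), connection c u (fst (X u (ind c))))"
proof -
  let ?K = "ind c" and ?z = "cmap (ind c) u"
  define DX where "DX = frechet_derivative (field_rep X ?K) (at ?z)"
  define DS where "DS = frechet_derivative (field_rep S ?K) (at ?z)"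
  have K: "?K \<in> slit_atlas \<A>" by (rule induced_in[OF c(1)])
  have "(field_rep X ?K has_derivative DX) (at ?z)"
    unfolding DX_def by (rule slit.smooth_field_has_derivative[OF X K c(2)])
  then have "((\<lambda>z. (0, fst (field_rep X ?K z))) has_derivative (\<lambda>a. (0::'b, fst (DX a)))) (at ?z)"
    by (intro has_derivative_Pair has_derivative_const has_derivative_fst)
  moreover have "field_rep (\<lambda>w. tangent_structure (X w)) ?K = (\<lambda>z. (0, fst (field_rep X ?K z)))"
    by (simp add: field_rep_def tangent_structure_def fun_eq_iff)
  ultimately have DJX: "frechet_derivative (field_rep (\<lambda>w. tangent_structure (X w)) ?K) (at ?z) = (\<lambda>a. (0, fst (DX a)))"
    by (simp add: frechet_derivative_eqI)
  have fstDS: "fst (DS a) = snd a" for a unfolding DS_def by (rule fst_S_derivative[OF c])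
  have cn: "connection c u a = (1/2) *\<^sub>R snd (DS (0, a))" for a by (simp add: connection_def DS_def)
  have "lie_derivative_J \<A> S X u ?K
      = ((0, fst (DX (S u ?K))) - DS (0, fst (X u ?K))) - (0, fst (DX (S u ?K) - DS (X u ?K)))"
    using K c(2) DJX by (simp add: lie_derivative_J_def lie_bracket_def tangent_structure_def DX_def DS_def)
  then show ?thesis
    by (intro prod_eqI) (simp_all add: horizontal_value_def scaleR_fun_def fstDS cn scaleR_diff_right[symmetric])
qed

lemma horizontal_value_tangent:
  assumes X: "smooth_vector_field_on (slit_atlas \<A>) W X" and u: "u \<in> W"
  shows "horizontal_value X u \<in> slit_tangent_space \<A> u"
proof -
  have W: "openin (manifold_topology (slit_atlas \<A>)) W" using X by (simp add: smooth_vector_field_on_def)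
  have sub: "W \<subseteq> slit_tangent_bundle \<A>" using W by (simp add: slit.openin_iff slit_carrier)
  have S: "smooth_vector_field_on (slit_atlas \<A>) W S"
    unfolding smooth_vector_field_on_def
  proof (intro conjI ballI W)
    show "S w \<in> slit_tangent_space \<A> w" if "w \<in> W" for w
      using S_smooth that sub by (auto simp: smooth_vector_field_on_def)
    fix K assume "K \<in> slit_atlas \<A>"
    then have "smooth_on (cmap K ` (slit_tangent_bundle \<A> \<inter> cdom K)) (field_rep S K)"
      using S_smooth by (simp add: smooth_vector_field_on_def)
    then show "smooth_on (cmap K ` (W \<inter> cdom K)) (field_rep S K)"
      by (rule smooth_on_subset) (use sub in blast)
  qed
  have JX: "smooth_vector_field_on (slit_atlas \<A>) W (\<lambda>w. tangent_structure (X w))"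
    unfolding smooth_vector_field_on_def
  proof (intro conjI ballI W)
    show "tangent_structure (X w) \<in> slit_tangent_space \<A> w" if "w \<in> W" for w
      using X that by (intro tangent_structure_in) (auto simp: smooth_vector_field_on_def)
    fix K assume K: "K \<in> slit_atlas \<A>"
    have O: "open (cmap K ` (W \<inter> cdom K))" using W K by (simp add: slit.openin_iff)
    have "smooth_on (cmap K ` (W \<inter> cdom K)) (field_rep X K)"
      using X K by (simp add: smooth_vector_field_on_def)
    then have "smooth_on (cmap K ` (W \<inter> cdom K)) (\<lambda>z. (0::'b, fst (field_rep X K z)))"
      by (intro smooth_on_Pair[OF O] smooth_on_const smooth_on_bounded_linear[OF O bounded_linear_fst])
    then show "smooth_on (cmap K ` (W \<inter> cdom K)) (field_rep (\<lambda>w. tangent_structure (X w)) K)"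
      by (simp add: field_rep_def tangent_structure_def)
  qed
  note sp = slit.subspace_tangent_space
  have "X u \<in> slit_tangent_space \<A> u" using X u by (simp add: smooth_vector_field_on_def)
  then show ?thesis
    unfolding horizontal_value_def lie_derivative_J_def
    by (intro subspace_scale[OF sp] subspace_diff[OF sp] tangent_structure_in
        slit.lie_bracket_tangent[OF S JX u] slit.lie_bracket_tangent[OF S X u])
qed

text \<open>
  Two extensions of \<open>\<xi>\<close> give tangent vectors with the same components in one chart, so the definite
  description has a unique witness.
\<close>
lemma horizontal_projector:
  assumes \<xi>: "\<xi> \<in> slit_tangent_space \<A> u" and c: "c \<in> \<A>" "u \<in> cdom (ind c)"
  shows "horizontal_projector \<A> S u \<xi> \<in> slit_tangent_space \<A> u"
    and "horizontal_projector \<A> S u \<xi> (ind c) = (fst (\<xi> (ind c)), connection c u (fst (\<xi> (ind c))))"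
proof -
  obtain X where X: "smooth_vector_field_on (slit_atlas \<A>) (cdom (ind c)) X" "X u = \<xi>"
    by (rule slit.smooth_extension[OF induced_in[OF c(1)] c(2) \<xi>])
  have "horizontal_projector \<A> S u \<xi> = horizontal_value X u"
    unfolding horizontal_projector_def
  proof (rule the_equality)
    show "\<exists>W Y. u \<in> W \<and> smooth_vector_field_on (slit_atlas \<A>) W Y \<and> Y u = \<xi> \<and>
        horizontal_value X u = (1/2) *\<^sub>R (\<xi> - lie_derivative_J \<A> S Y u)"
      using X c(2) unfolding horizontal_value_def by blast
    fix \<eta> assume "\<exists>W Y. u \<in> W \<and> smooth_vector_field_on (slit_atlas \<A>) W Y \<and> Y u = \<xi> \<and>
        \<eta> = (1/2) *\<^sub>R (\<xi> - lie_derivative_J \<A> S Y u)"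
    then obtain W Y where Y: "u \<in> W" "smooth_vector_field_on (slit_atlas \<A>) W Y" "Y u = \<xi>" "\<eta> = horizontal_value Y u"
      unfolding horizontal_value_def by blast
    show "\<eta> = horizontal_value X u"
      unfolding Y(4)
    proof (rule slit.tangent_eqI[OF horizontal_value_tangent[OF Y(2,1)] horizontal_value_tangent[OF X(1) c(2)]
          induced_in[OF c(1)] c(2)])
      show "horizontal_value Y u (ind c) = horizontal_value X u (ind c)"
        by (simp only: horizontal_value_component[OF Y(2,1) c] horizontal_value_component[OF X(1) c(2) c] Y(3) X(2))
    qed
  qed
  then show "horizontal_projector \<A> S u \<xi> \<in> slit_tangent_space \<A> u"
    "horizontal_projector \<A> S u \<xi> (ind c) = (fst (\<xi> (ind c)), connection c u (fst (\<xi> (ind c))))"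
    using horizontal_value_tangent[OF X(1) c(2)] horizontal_value_component[OF X(1) c(2) c] X(2) by simp_all
qed

end

text \<open>
  Used with the fibre coordinate of \<open>u\<close>, so that the last vertical frame vector becomes the Liouville
  vector.
\<close>
lemma basis_ending_in:
  fixes y :: "'e::euclidean_space"
  assumes "y \<noteq> 0"
  obtains m and f :: "nat \<Rightarrow> 'e" and g :: "nat \<Rightarrow> 'e \<Rightarrow> real" where "DIM('e) = Suc m" "f m = y"
    "\<And>i. linear (g i)" "\<And>i j. i \<le> m \<Longrightarrow> j \<le> m \<Longrightarrow> g i (f j) = (if i = j then 1 else 0)"
    "\<And>x. x = (\<Sum>i\<le>m. g i x *\<^sub>R f i)"
proof -
  have "independent {y}" using assms by (simp add: independent_insert)
  then obtain B where B: "{y} \<subseteq> B" "independent B" "UNIV \<subseteq> span B"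
    by (rule maximal_independent_subset_extend[OF subset_UNIV])
  then have sp: "span B = UNIV" by blast
  have fin: "finite B" using B(2) by (rule independent_imp_finite)
  have "card B = DIM('e)" using dim_eq_card_independent[OF B(2)] dim_span[of B] by (simp add: sp)
  define m where "m = card (B - {y})"
  have m: "DIM('e) = Suc m"
    using \<open>card B = DIM('e)\<close> card_Suc_Diff1[OF fin, of y] B(1) by (simp add: m_def)
  obtain k where k: "bij_betw k {0..<m} (B - {y})"
    unfolding m_def using ex_bij_betw_nat_finite[of "B - {y}"] fin by auto
  define f where "f i = (if i < m then k i else y)" for i
  have f_eq: "f ` {..<m} = B - {y}" "inj_on f {..<m}"
    using bij_betw_imp_surj_on[OF k] bij_betw_imp_inj_on[OF k]
    by (auto simp: f_def atLeast0LessThan inj_on_def image_def)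
  have atm: "{..m} = insert m {..<m}" by auto
  have fB: "f ` {..m} = B" using B(1) f_eq(1) unfolding atm by (auto simp: f_def)
  have finj: "inj_on f {..m}" unfolding atm inj_on_insert using f_eq by (auto simp: f_def)
  define g where "g i x = representation B x (f i)" for i x
  show thesis
  proof
    show "DIM('e) = Suc m" by (rule m)
    show "f m = y" by (simp add: f_def)
    show "linear (g i)" for i
      by (rule linearI) (simp_all add: g_def representation_add representation_scale B(2) sp)
    show "g i (f j) = (if i = j then 1 else 0)" if "i \<le> m" "j \<le> m" for i j
    proof -
      have "f j \<in> B" using fB that(2) by blast
      then show ?thesis using inj_onD[OF finj, of i j] that by (auto simp: g_def representation_basis[OF B(2)])
    qed
    fix x
    have "x = (\<Sum>b\<in>B. representation B x b *\<^sub>R b)"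
      using sum_representation_eq[OF B(2) _ fin subset_refl, of x] sp by simp
    also have "\<dots> = (\<Sum>i\<le>m. g i x *\<^sub>R f i)"
      unfolding g_def fB[symmetric] using sum.reindex[OF finj] by (simp add: o_def)
    finally show "x = (\<Sum>i\<le>m. g i x *\<^sub>R f i)" .
  qed
qed

context spray_bundle
begin

text \<open>
  The frame is obtained from a basis \<open>f\<close> of the coordinate space that ends in the fibre coordinate of
  \<open>u\<close>: the horizontal vectors have components \<open>(f i, N (f i))\<close>, the vertical ones \<open>(0, f i)\<close>.
\<close>
lemma symbol_involutive:
  assumes u: "u \<in> slit_tangent_bundle \<A>" shows "symbol_involutive \<A> S u"
proof -
  obtain c where c: "c \<in> \<A>" "fst u \<in> cdom c"
    using u by (auto simp: slit_tangent_bundle_def carrier_of_def)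
  define K where "K = ind c"
  have K: "K \<in> slit_atlas \<A>" "u \<in> cdom K" using c u by (auto simp: K_def induced_in induced_cdom)
  have uc: "u \<in> cdom (ind c)" using K(2) by (simp add: K_def)
  let ?T = "slit_tangent_space \<A> u"
  define N where "N = connection c u"
  have N: "linear N" unfolding N_def by (rule linear_connection[OF c(1) uc])
  obtain m f g where m: "DIM('b) = Suc m" and fm: "f m = snd u c" and lin_g: "\<And>i. linear (g i)"
    and dual: "\<And>i j. i \<le> m \<Longrightarrow> j \<le> m \<Longrightarrow> g i (f j) = (if i = j then 1 else 0)"
    and repr: "\<And>x. x = (\<Sum>i\<le>m. g i x *\<^sub>R f i)"
    by (rule basis_ending_in[OF slit_component_nonzero[OF c(1) uc]]) (rule that)
  define vec where "vec = slit.tangent_of K u"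
  have vec_T: "vec w \<in> ?T" for w unfolding vec_def by (rule slit.tangent_of_in[OF K])
  have vec_K: "vec w K = w" for w unfolding vec_def by (rule slit.tangent_of_component[OF K])
  have eqI: "\<xi> = \<eta>" if "\<xi> \<in> ?T" "\<eta> \<in> ?T" "\<xi> K = \<eta> K" for \<xi> \<eta>
    by (rule slit.tangent_eqI[OF that(1,2) K that(3)])
  define H where "H i = vec (f i, N (f i))" for i
  define v where "v i = vec (0, f i)" for i
  define \<alpha> where "\<alpha> i \<xi> = g i (fst (\<xi> K))" for i and \<xi> :: "('a, 'b) ttvec"
  define \<beta> where "\<beta> i \<xi> = g i (snd (\<xi> K) - N (fst (\<xi> K)))" for i and \<xi> :: "('a, 'b) ttvec"
  have T: "subspace ?T" by (rule slit.subspace_tangent_space)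
  have comb: "(\<Sum>i\<le>m. a i *\<^sub>R H i) \<in> ?T" "(\<Sum>i\<le>m. a i *\<^sub>R v i) \<in> ?T" for a
    unfolding H_def v_def by (intro subspace_sum[OF T] subspace_scale[OF T] vec_T)+
  have comb_K: "(\<Sum>i\<le>m. a i *\<^sub>R H i) K = (\<Sum>i\<le>m. a i *\<^sub>R f i, N (\<Sum>i\<le>m. a i *\<^sub>R f i))"
    "(\<Sum>i\<le>m. a i *\<^sub>R v i) K = (0, \<Sum>i\<le>m. a i *\<^sub>R f i)" for a
    by (simp_all add: sum_fun_apply scaleR_fun_def H_def v_def vec_K sum_prod linear_sum[OF N] linear_scale[OF N])
  have h: "horizontal_projector \<A> S u \<xi> \<in> ?T"
    "horizontal_projector \<A> S u \<xi> K = (fst (\<xi> K), N (fst (\<xi> K)))" if "\<xi> \<in> ?T" for \<xi>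
    using horizontal_projector[OF that c(1) uc] by (simp_all add: K_def N_def)
  have C_T: "liouville \<A> u \<in> ?T"
  proof -
    have "S u \<in> ?T" "tangent_structure (S u) = liouville \<A> u"
      using spray u by (auto simp: spray_def smooth_vector_field_on_def)
    then show ?thesis using tangent_structure_in by metis
  qed
  interpret adapted_frame ?T tangent_structure "horizontal_projector \<A> S u" "liouville \<A> u" m H v \<alpha> \<beta>
  proof (rule adapted_frame.intro)
    show "subspace ?T" by (rule T)
    show "linear (\<alpha> i)" for i
      by (rule linearI) (simp_all add: \<alpha>_def scaleR_fun_def linear_add[OF lin_g] linear_scale[OF lin_g])
    show "linear (\<beta> i)" for i
      by (rule linearI) (simp_all add: \<beta>_def scaleR_fun_def linear_add[OF lin_g] linear_scale[OF lin_g]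
          linear_diff[OF lin_g] linear_add[OF N] linear_scale[OF N] right_diff_distrib)
    show "H i \<in> ?T" "v i \<in> ?T" for i by (simp_all add: H_def v_def vec_T)
    fix i j assume ij: "i \<le> m" "j \<le> m"
    show "\<alpha> i (H j) = (if i = j then 1 else 0)" "\<beta> i (H j) = 0"
      "\<alpha> i (v j) = 0" "\<beta> i (v j) = (if i = j then 1 else 0)"
      by (simp_all add: \<alpha>_def \<beta>_def H_def v_def vec_K dual ij linear_0[OF lin_g] linear_0[OF N])
  next
    fix \<xi> assume \<xi>: "\<xi> \<in> ?T"
    have \<alpha>: "(\<Sum>i\<le>m. \<alpha> i \<xi> *\<^sub>R f i) = fst (\<xi> K)" unfolding \<alpha>_def by (rule repr[symmetric])
    have \<beta>: "(\<Sum>i\<le>m. \<beta> i \<xi> *\<^sub>R f i) = snd (\<xi> K) - N (fst (\<xi> K))" unfolding \<beta>_def by (rule repr[symmetric])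
    show "\<xi> = (\<Sum>i\<le>m. \<alpha> i \<xi> *\<^sub>R H i) + (\<Sum>i\<le>m. \<beta> i \<xi> *\<^sub>R v i)"
      by (rule eqI[OF \<xi> subspace_add[OF T comb]]) (simp add: comb_K \<alpha> \<beta>)
    show "tangent_structure \<xi> = (\<Sum>i\<le>m. \<alpha> i \<xi> *\<^sub>R v i)"
      by (rule eqI[OF tangent_structure_in[OF \<xi>] comb(2)]) (simp add: comb_K \<alpha> tangent_structure_def)
    show "horizontal_projector \<A> S u \<xi> = (\<Sum>i\<le>m. \<alpha> i \<xi> *\<^sub>R H i)"
      by (rule eqI[OF h(1)[OF \<xi>] comb(1)]) (simp add: comb_K \<alpha> h(2)[OF \<xi>])
  next
    have "liouville \<A> u K = (0, f m)" using K by (simp add: liouville_def fm K_def induced_cmap)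
    then show "liouville \<A> u = v m"
      using eqI[OF C_T vec_T, of "(0, f m)"] by (simp add: v_def vec_K)
  qed
  have "vertical_space \<A> u = {X \<in> ?T. \<forall>i\<le>m. \<alpha> i X = 0}"
  proof -
    have "(\<forall>i\<le>m. \<alpha> i X = 0) \<longleftrightarrow> fst (X K) = 0" for X
    proof
      assume "\<forall>i\<le>m. \<alpha> i X = 0"
      then have "(\<Sum>i\<le>m. g i (fst (X K)) *\<^sub>R f i) = 0" by (simp add: \<alpha>_def)
      then show "fst (X K) = 0" by (simp only: repr[symmetric])
    qed (simp add: \<alpha>_def linear_0[OF lin_g])
    then show ?thesis using vertical_space_iff[OF c(1) uc] by (auto simp: K_def)
  qed
  then have sb: "semibasic_forms \<A> u = semibasic"
    unfolding semibasic_forms_def semibasic_def by blast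
  have g1: "g1 \<A> S u = G1"
    by (simp add: g1_def G1_def tensors1_def sb symbol1_def tau_def zero_prod_def)
  have g2: "g2 \<A> S u = G2"
  proof -
    have "B \<in> g2 \<A> S u \<longleftrightarrow> B \<in> G2" for B
    proof (cases "B \<in> hom_on ?T (hom_on ?T semibasic)")
      case True
      have B: "B X \<in> hom_on ?T semibasic" if "X \<in> ?T" for X using True that by (simp add: hom_on_def)
      have z: "B X = 0" if "X \<notin> ?T" for X using True that by (simp add: hom_on_def)
      have G: "symbol1 \<A> S u A = 0 \<longleftrightarrow> A \<in> G1" if "A \<in> hom_on ?T semibasic" for A
        using that unfolding g1[symmetric] g1_def tensors1_def sb by blast
      have "symbol1 \<A> S u 0 = 0" by (simp add: symbol1_def tau_def zero_prod_def fun_eq_iff)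
      then have "symbol1 \<A> S u (B X) = 0 \<longleftrightarrow> (X \<in> ?T \<longrightarrow> B X \<in> G1)" for X
        using G[OF B] z by (cases "X \<in> ?T") simp_all
      then have "symbol2 \<A> S u B = 0 \<longleftrightarrow> (\<forall>X\<in>?T. B X \<in> G1)"
        by (simp only: symbol2_def fun_eq_iff[of "\<lambda>X. symbol1 \<A> S u (B X)"] zero_fun_apply Ball_def)
      then show ?thesis using True by (auto simp: g2_def tensors2_def tensors1_def sb G2_def)
    qed (simp add: g2_def tensors2_def tensors1_def sb G2_def)
    then show ?thesis by blast
  qed
  have "quasi_regular \<A> S u regular_basis"
    unfolding quasi_regular_def g1_sub_def g1 g2 m by (rule cartan_equality)
  moreover have "length regular_basis = 2 * DIM('b)" by (simp add: regular_basis_def m)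
  ultimately show ?thesis using is_basis_regular_basis unfolding symbol_involutive_def by blast
qed

end

theorem theorem4p2:
  fixes \<A> :: "('p, real ^ 'n) chart set"
    and S :: "('p, real ^ 'n) tpoint \<Rightarrow> ('p, real ^ 'n) ttvec"
  assumes "smooth_manifold \<A>"
    and "spray \<A> S"
  shows "\<forall>u\<in>slit_tangent_bundle \<A>. symbol_involutive \<A> S u"
proof -
  interpret spray_bundle \<A> S
    by unfold_locales (use assms in \<open>auto simp: smooth_manifold_def\<close>)
  show ?thesis using symbol_involutive by blast
qed

end
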